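(* Let $r\ge 0$ be a real number and $\mathcal{P}_T>0$. Suppose $N_A=1$ (SIMOME scenario). Then among all input distributions $p_{(u,x)}$ with $\mathbb{E}[|x|^2]\le\mathcal{P}_T$, the secrecy outage probability $\mathrm{SOP}(r)$ is minimized by the one for which $u\equiv x$ and $x$ is a (circularly symmetric) complex Gaussian random variable with variance $\mathcal{P}_T$; that is, $$\min_{\substack{p_{(u,x)}\\ \mathbb{E}[|x|^2]\le\mathcal{P}_T}}\mathrm{SOP}(r)=\mathbb{P}\left[\log\left(\frac{1+\mathcal{P}_T\lVert\mathbf{h}\rVert^2}{1+\mathcal{P}_T\lVert\mathbf{g}\rVert^2}\right)<r\right].$$
   Context: Channel model (SIMOME: single transmit antenna). Let $N_B,N_E\ge1$ be integers. A message $u$, a random variable in an arbitrary set $\mathcal{U}$, is encoded into a complex random variable $x\in\mathbb{C}$; the joint law $p_{(u,x)}$ is the input distribution (the set $\mathcal U$, the law of $u$ and the conditional law of $x$ given $u$ are all free). The legitimate receiver observes $\mathbf{y}=\mathbf{h}x+\mathbf{w}_B\in\mathbb{C}^{N_B}$ and the eavesdropper observes $\mathbf{z}=\mathbf{g}x+\mathbf{w}_E\in\mathbb{C}^{N_E}$, where $\mathbf{h}\in\mathbb{C}^{N_B}$ (legitimate channel) and $\mathbf{g}\in\mathbb{C}^{N_E}$ (eavesdropper channel) are random vectors, with arbitrary given distributions, independent of $(u,x)$, and $\mathbf{w}_B,\mathbf{w}_E$ are circularly symmetric complex Gaussian noise vectors with identity covariance, independent of each other and of everything else. $\lVert\cdot\rVert$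 is the Euclidean norm; $\log$ is base 2; $I(\cdot;\cdot)$ is Shannon mutual information in bits. Instantaneous quantities: $I(u;\mathbf{y})$ and $I(u;\mathbf{z})$ denote the mutual informations for the instantaneous channel states, i.e. $I(u;\mathbf{y}\mid\mathbf{h}=\mathbf{h}_0)$ evaluated at $\mathbf{h}_0=\mathbf{h}$ and $I(u;\mathbf{z}\mid\mathbf{g}=\mathbf{g}_0)$ evaluated at $\mathbf{g}_0=\mathbf{g}$; they are thus random variables, functions of $(\mathbf{h},\mathbf{g})$. The secrecy outage probability is $\mathrm{SOP}(r)=\mathbb{P}[I(u;\mathbf{y})-I(u;\mathbf{z})<r]$, the probability being over $(\mathbf{h},\mathbf{g})$. The notation $u\equiv x$ means that $u$ is identified with $x$ (no precoding).
   Formalization: Minimality is asserted only for r > 0: at r = 0, since SOP uses a strict inequality, the input x = 0 has SOP(0) = 0, while the right-hand side is P[‖h‖ < ‖g‖], which may be positive; the formula for the Gaussian input's SOP still covers all r ≥ 0. *)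

theory Defs
  imports "HOL-Probability.Probability"
begin

text \<open>
  A circularly symmetric complex Gaussian of variance \<open>v\<close> has independent real and imaginary
  parts, each of variance \<open>v / 2\<close>; \<open>cgauss_density v\<close> is its density on \<open>\<complex> = \<real>\<^sup>2\<close>.
\<close>

definition cgauss_density :: "real \<Rightarrow> complex \<Rightarrow> real" where
  "cgauss_density v z = exp (- (cmod z)\<^sup>2 / v) / (pi * v)"

definition cgauss :: "real \<Rightarrow> complex measure" where
  "cgauss v = density lborel (\<lambda>z. ennreal (cgauss_density v z))"

definition cgauss_noise :: "(complex ^ 'n::finite) measure" where
  "cgauss_noise = density lborel (\<lambda>w. ennreal (\<Prod>i\<in>UNIV. cgauss_density 1 (w $ i)))"

text \<open>
  Joint laws of \<open>(u, x)\<close>, where the message \<open>u\<close> takes values in the arbitrary measurable space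
  \<open>U\<close>, under the power constraint. The second moment is a nonnegative integral, so an input of
  infinite power is excluded.
\<close>

definition input_distributions :: "'u measure \<Rightarrow> real \<Rightarrow> ('u \<times> complex) measure set" where
  "input_distributions U P =
    {p. prob_space p \<and> sets p = sets (U \<Otimes>\<^sub>M (borel :: complex measure)) \<and>
        (\<integral>\<^sup>+ q. ennreal ((cmod (snd q))\<^sup>2) \<partial>p) \<le> ennreal P}"

text \<open>
  \<open>I(u; h x + w)\<close> in bits for a fixed channel vector \<open>h\<close>, on the probability space carrying
  \<open>((u, x), w)\<close>. The library mutual information is a Bochner integral, thus \<open>0\<close> when the
  integrand is not integrable. This does not happen here: for an input of finite power the joint
  law is absolutely continuous with respect to the product of the marginals, and the mutual
  information is finite.
\<close>

definition instantaneous_MI ::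
    "'u measure \<Rightarrow> ('u \<times> complex) measure \<Rightarrow> complex ^ 'n::finite \<Rightarrow> real" where
  "instantaneous_MI U p h =
    prob_space.mutual_information (p \<Otimes>\<^sub>M cgauss_noise) 2 U borel
      (\<lambda>((u, x), w). u) (\<lambda>((u, x), w). x *s h + w)"

text \<open>
  The channels \<open>h\<close> and \<open>g\<close> are random vectors on \<open>M\<close>, with an arbitrary joint law. As the
  inequality is strict, an input with \<open>x = 0\<close> (both mutual informations vanish) has outage
  probability \<open>0\<close> at \<open>r = 0\<close>, whatever the channels are.
\<close>

definition SOP ::
    "'w measure \<Rightarrow> ('w \<Rightarrow> complex ^ 'b::finite) \<Rightarrow> ('w \<Rightarrow> complex ^ 'e::finite) \<Rightarrow>
     'u measure \<Rightarrow> ('u \<times> complex) measure \<Rightarrow> real \<Rightarrow> real" where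
  "SOP M h g U p r =
    measure M {\<omega> \<in> space M. instantaneous_MI U p (h \<omega>) - instantaneous_MI U p (g \<omega>) < r}"

text \<open>The input with \<open>u = x\<close> (no precoding) and \<open>x\<close> complex Gaussian of variance \<open>P\<close>.\<close>

definition gaussian_input :: "real \<Rightarrow> (complex \<times> complex) measure" where
  "gaussian_input P = distr (cgauss P) (borel \<Otimes>\<^sub>M borel) (\<lambda>x. (x, x))"

end

theory Submission
  imports Defs
begin

text \<open>
  Only the component of \<open>h x + w\<close> along \<open>h\<close> carries information about \<open>x\<close>, so \<open>I(u; h x + w)\<close> is a
  function \<open>J n\<close> of \<open>n = \<parallel>h\<parallel>\<close>, the mutual information of the scalar channel \<open>y = n x + w\<close>. For
  \<open>m \<le> n\<close> and \<open>a = m / n\<close>, \<open>b = sqrt (1 - a\<^sup>2)\<close>, the weaker channel is a degraded version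
  \<open>y' = a y + b w'\<close> of the stronger one. Hence \<open>0 \<le> J n - J m = I(u; y | y') \<le> I(x; y | y')\<close>, and the
  last term is at most its value \<open>ln ((1 + P n\<^sup>2) / (1 + P m\<^sup>2))\<close> for a Gaussian \<open>x\<close> of variance \<open>P\<close>. So
  if the Gaussian input is in outage at a rate \<open>r > 0\<close>, every input is.

  Both estimates reduce to \<open>ln t \<le> t - 1\<close> for ratios \<open>t\<close> of densities, whose expectations are at most
  \<open>1\<close> because the kernel from \<open>y'\<close> to \<open>y\<close> for the noise alone maps each output density of gain \<open>n\<close> to
  the one of gain \<open>m\<close> (the map \<open>(y, w') \<mapsto> (a y + b w', b y - a w')\<close> is an orthogonal involution).
\<close>

text \<open>All densities are taken relative to the law of the noise instead of Lebesgue measure: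
  this reference is invariant under the reflection, and in \<open>complex ^ 'n\<close> it makes the
  output density a function of one scalar projection. The message space is arbitrary, so a
  conditional law of \<open>x\<close> given \<open>u\<close> need not exist; a Radon-Nikodym
  derivative \<open>D\<close>, characterised by its integrals, replaces it. The main obstacle is
  integrability, since the logarithms of \<open>D\<close> cannot be estimated alone. Three ratios
  are used, and minus the expected logarithm of each is an information quantity:
  \<open>I(x; y | u, y')\<close>, the divergence of \<open>y\<close> given \<open>y'\<close> from
  its Gaussian counterpart, and \<open>I(u; y | y')\<close>. The first two, with an explicit
  quadratic, bound the integrand of \<open>J n - J m\<close> from above, the third from below, so
  integrability and both inequalities arrive together. The choice \<open>m = 0\<close>, where no
  information passes, then yields integrability of a single logarithm. The final comparison is
  between outage events, point by point, so the joint law of the two channels never enters.\<close>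

section \<open>Lebesgue measure under affine maps, reflections and rotations\<close>

lemma nn_integral_lborel_affine:
  fixes f :: "'a::euclidean_space \<Rightarrow> ennreal"
  assumes [measurable]: "f \<in> borel_measurable borel" and "c \<noteq> 0"
  shows "integral\<^sup>N lborel f = ennreal (\<bar>c\<bar> ^ DIM('a)) * (\<integral>\<^sup>+x. f (t + c *\<^sub>R x) \<partial>lborel)"
  by (subst lborel_affine[OF assms(2), of t])
     (simp add: nn_integral_density nn_integral_distr nn_integral_cmult)

lemma nn_integral_lborel_translate:
  fixes f :: "'a::euclidean_space \<Rightarrow> ennreal"
  assumes "f \<in> borel_measurable borel"
  shows "integral\<^sup>N lborel f = (\<integral>\<^sup>+x. f (t + x) \<partial>lborel)"
  using nn_integral_lborel_affine[OF assms, of 1 t] by simp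

text \<open>Two affine substitutions in one variable, with Fubini between them, take the place of a
  determinant on the product space. Their Jacobians are powers of \<open>1 / b\<close> and of
  \<open>b\<close> in absolute value and cancel. The case \<open>b = 0\<close>, where
  \<open>a\<close> is 1 or -1, is separate because the first substitution divides by
  \<open>b\<close>.\<close>

lemma nn_integral_lborel_reflection:
  fixes f :: "'a::euclidean_space \<times> 'a \<Rightarrow> ennreal"
  assumes [measurable]: "f \<in> borel_measurable (borel \<Otimes>\<^sub>M borel)" and ab: "a\<^sup>2 + b\<^sup>2 = 1"
  shows "(\<integral>\<^sup>+y. \<integral>\<^sup>+w. f (a *\<^sub>R y + b *\<^sub>R w, b *\<^sub>R y - a *\<^sub>R w) \<partial>lborel \<partial>lborel) =
    (\<integral>\<^sup>+y. \<integral>\<^sup>+w. f (y, w) \<partial>lborel \<partial>lborel)"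
proof (cases "b = 0")
  case True
  then have a: "a \<noteq> 0" "\<bar>a\<bar> = 1" using ab by (auto simp: power2_eq_1_iff)
  have "(\<integral>\<^sup>+y. \<integral>\<^sup>+w. f (a *\<^sub>R y, - a *\<^sub>R w) \<partial>lborel \<partial>lborel) = (\<integral>\<^sup>+y. \<integral>\<^sup>+w. f (a *\<^sub>R y, w) \<partial>lborel \<partial>lborel)"
  proof (rule nn_integral_cong)
    fix y :: 'a
    show "(\<integral>\<^sup>+w. f (a *\<^sub>R y, - a *\<^sub>R w) \<partial>lborel) = (\<integral>\<^sup>+w. f (a *\<^sub>R y, w) \<partial>lborel)"
      using nn_integral_lborel_affine[of "\<lambda>w. f (a *\<^sub>R y, w)" "- a" 0] a by simp
  qed
  also have "\<dots> = (\<integral>\<^sup>+y. \<integral>\<^sup>+w. f (y, w) \<partial>lborel \<partial>lborel)"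
    by (subst nn_integral_lborel_affine[where c = a and t = 0 and f = "\<lambda>y. \<integral>\<^sup>+w. f (y, w) \<partial>lborel"]) (use a in auto)
  finally show ?thesis using True by simp
next
  case False
  let ?n = "ennreal (\<bar>b\<bar> ^ DIM('a))"
  have n: "ennreal (\<bar>1 / b\<bar> ^ DIM('a)) * ?n = 1"
    using False by (simp add: ennreal_mult'[symmetric] power_mult_distrib[symmetric])
  have "(\<integral>\<^sup>+y. \<integral>\<^sup>+w. f (a *\<^sub>R y + b *\<^sub>R w, b *\<^sub>R y - a *\<^sub>R w) \<partial>lborel \<partial>lborel) =
    (\<integral>\<^sup>+y. ennreal (\<bar>1 / b\<bar> ^ DIM('a)) * (\<integral>\<^sup>+s. f (s, (1 / b) *\<^sub>R (y - a *\<^sub>R s)) \<partial>lborel) \<partial>lborel)"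
  proof (rule nn_integral_cong)
    \<comment> \<open>With \<open>y\<close> fixed, the new variable is \<open>s = a y + b w\<close>,
      that is \<open>w = - (a / b) y + (1 / b) s\<close>; the constraint on \<open>a\<close> and
      \<open>b\<close> turns the second coordinate into \<open>(y - a s) / b\<close>.\<close>
    fix y :: 'a
    have "b *\<^sub>R y - a *\<^sub>R (- (a / b) *\<^sub>R y + (1 / b) *\<^sub>R s) = (1 / b) *\<^sub>R (y - a *\<^sub>R s)" for s
    proof -
      have "b + a * a / b = 1 / b" using ab False by (simp add: field_simps power2_eq_square)
      then have "b *\<^sub>R y + (a * a / b) *\<^sub>R y = (1 / b) *\<^sub>R y" by (metis scaleR_left_distrib)
      then show ?thesis by (simp add: algebra_simps)
    qed
    moreover have "a *\<^sub>R y + b *\<^sub>R (- (a / b) *\<^sub>R y + (1 / b) *\<^sub>R s) = s" for s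
      using False by (simp add: algebra_simps)
    ultimately show "(\<integral>\<^sup>+w. f (a *\<^sub>R y + b *\<^sub>R w, b *\<^sub>R y - a *\<^sub>R w) \<partial>lborel) =
      ennreal (\<bar>1 / b\<bar> ^ DIM('a)) * (\<integral>\<^sup>+s. f (s, (1 / b) *\<^sub>R (y - a *\<^sub>R s)) \<partial>lborel)"
      by (subst nn_integral_lborel_affine[where c = "1 / b" and t = "- (a / b) *\<^sub>R y"]) (use False in simp_all)
  qed
  also have "\<dots> = ennreal (\<bar>1 / b\<bar> ^ DIM('a)) * (\<integral>\<^sup>+s. \<integral>\<^sup>+y. f (s, (1 / b) *\<^sub>R (y - a *\<^sub>R s)) \<partial>lborel \<partial>lborel)"
    by (simp add: nn_integral_cmult, subst lborel_pair.Fubini') auto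
  also have "\<dots> = ennreal (\<bar>1 / b\<bar> ^ DIM('a)) * (\<integral>\<^sup>+s. ?n * (\<integral>\<^sup>+v. f (s, v) \<partial>lborel) \<partial>lborel)"
  \<comment> \<open>Now \<open>s\<close> is fixed and the substitution is
    \<open>y = a s + b v\<close>.\<close>
  proof -
    have "(\<integral>\<^sup>+y. f (s, (1 / b) *\<^sub>R (y - a *\<^sub>R s)) \<partial>lborel) = ?n * (\<integral>\<^sup>+v. f (s, v) \<partial>lborel)" for s
      using nn_integral_lborel_affine[of "\<lambda>y. f (s, (1 / b) *\<^sub>R (y - a *\<^sub>R s))" b "a *\<^sub>R s"] False
      by simp
    then show ?thesis by simp
  qed
  also have "\<dots> = (\<integral>\<^sup>+s. \<integral>\<^sup>+v. f (s, v) \<partial>lborel \<partial>lborel)"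
    using n by (simp add: nn_integral_cmult mult.assoc[symmetric])
  finally show ?thesis .
qed

lemma borel_measurable_cnj [measurable]: "cnj \<in> borel \<rightarrow>\<^sub>M borel"
  by (intro borel_measurable_continuous_onI continuous_intros)

lemma measurable_Complex [measurable]: "(\<lambda>(a, b). Complex a b) \<in> borel \<Otimes>\<^sub>M borel \<rightarrow>\<^sub>M borel"
  unfolding Complex_eq split_def by measurable

lemma lborel_complex_eq:
  "(lborel :: complex measure) = distr (lborel \<Otimes>\<^sub>M lborel) borel (\<lambda>(a, b). Complex a b)"
proof (rule lborel_eqI)
  fix l u :: complex
  assume le: "\<And>b. b \<in> Basis \<Longrightarrow> l \<bullet> b \<le> u \<bullet> b"
  have le': "Re l \<le> Re u" "Im l \<le> Im u"
    using le[of 1] le[of \<i>] by (auto simp: Basis_complex_def inner_complex_def)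
  have "(\<lambda>(a, b). Complex a b) -` box l u = {Re l<..<Re u} \<times> {Im l<..<Im u}"
    by (auto simp: box_def Basis_complex_def inner_complex_def)
  then show "emeasure (distr (lborel \<Otimes>\<^sub>M lborel) borel (\<lambda>(a, b). Complex a b)) (box l u) = ennreal (\<Prod>b\<in>Basis. (u - l) \<bullet> b)"
    using le' by (subst emeasure_distr)
      (auto simp: space_pair_measure lborel.emeasure_pair_measure_Times Basis_complex_def inner_complex_def ennreal_mult complex_eq_iff)
qed simp

lemma nn_integral_lborel_complex:
  fixes f :: "complex \<Rightarrow> ennreal"
  assumes [measurable]: "f \<in> borel_measurable borel"
  shows "integral\<^sup>N lborel f = (\<integral>\<^sup>+a. \<integral>\<^sup>+b. f (Complex a b) \<partial>lborel \<partial>lborel)"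
proof -
  show ?thesis
    by (subst lborel_complex_eq, subst nn_integral_distr)
       (simp_all add: lborel.nn_integral_fst[symmetric])
qed

text \<open>A rotation is a product of two reflections: in real coordinates
  \<open>z \<mapsto> d * cnj z\<close> is the map of \<open>nn_integral_lborel_reflection\<close>
  with \<open>a = Re d\<close> and \<open>b = Im d\<close>. It is used once with
  \<open>d = 1\<close> and once with \<open>d = e\<close>.\<close>

lemma nn_integral_lborel_unit_mult:
  fixes f :: "complex \<Rightarrow> ennreal"
  assumes [measurable]: "f \<in> borel_measurable borel" and e: "cmod e = 1"
  shows "(\<integral>\<^sup>+z. f (e * z) \<partial>lborel) = integral\<^sup>N lborel f"
proof -
  have refl: "(\<integral>\<^sup>+z. g (d * cnj z) \<partial>lborel) = integral\<^sup>N lborel g"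
    if [measurable]: "g \<in> borel_measurable borel" and d: "cmod d = 1" for g :: "complex \<Rightarrow> ennreal" and d
  proof -
    have d1: "(Re d)\<^sup>2 + (Im d)\<^sup>2 = 1" using d by (simp add: cmod_def)
    have meas: "(\<lambda>p. g (case p of (a, b) \<Rightarrow> Complex a b)) \<in> borel_measurable (borel \<Otimes>\<^sub>M borel)"
      by measurable
    have "(\<integral>\<^sup>+z. g (d * cnj z) \<partial>lborel) = (\<integral>\<^sup>+a. \<integral>\<^sup>+b. g (d * cnj (Complex a b)) \<partial>lborel \<partial>lborel)"
      by (rule nn_integral_lborel_complex) measurable
    also have "\<dots> = (\<integral>\<^sup>+a. \<integral>\<^sup>+b. g (Complex (Re d * a + Im d * b) (Im d * a - Re d * b)) \<partial>lborel \<partial>lborel)"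
      by (intro nn_integral_cong arg_cong[where f = g]) (simp add: complex_eq_iff)
    also have "\<dots> = (\<integral>\<^sup>+a. \<integral>\<^sup>+b. g (Complex a b) \<partial>lborel \<partial>lborel)"
      using nn_integral_lborel_reflection[OF meas d1] by simp
    also have "\<dots> = integral\<^sup>N lborel g"
      by (rule nn_integral_lborel_complex[symmetric]) measurable
    finally show ?thesis .
  qed
  have "(\<integral>\<^sup>+z. f (e * z) \<partial>lborel) = (\<integral>\<^sup>+z. f (e * cnj z) \<partial>lborel)"
    using refl[of "\<lambda>z. f (e * z)" 1] by simp
  also have "\<dots> = integral\<^sup>N lborel f" using refl[of f e] e by simp
  finally show ?thesis .
qed

section \<open>Complex Gaussian measures\<close>

lemma cgauss_density_nonneg: "v > 0 \<Longrightarrow> 0 \<le> cgauss_density v z"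
  by (simp add: cgauss_density_def)

lemma borel_measurable_cgauss_density [measurable]: "cgauss_density v \<in> borel_measurable borel"
  unfolding cgauss_density_def by measurable

lemma sets_cgauss [measurable_cong, simp]: "sets (cgauss v) = sets borel"
  by (simp add: cgauss_def)

lemma space_cgauss [simp]: "space (cgauss v) = UNIV"
  by (simp add: cgauss_def)

lemma cgauss_density_eq_normal:
  assumes "v > 0"
  shows "cgauss_density v z = (\<Prod>b\<in>Basis. normal_density 0 (sqrt (v / 2)) (z \<bullet> b))"
proof -
  have "cmod z ^ 2 = (Re z)\<^sup>2 + (Im z)\<^sup>2" by (simp add: cmod_power2)
  then show ?thesis using assms
    by (simp add: cgauss_density_def normal_density_def Basis_complex_def inner_complex_def complex_eq_iff
      exp_add[symmetric] real_sqrt_mult field_simps)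
qed

lemma prob_space_cgauss:
  assumes "v > 0"
  shows "prob_space (cgauss v)"
proof
  have "emeasure (cgauss v) (space (cgauss v)) =
    (\<integral>\<^sup>+z. (\<Prod>b\<in>Basis. ennreal (normal_density 0 (sqrt (v / 2)) (z \<bullet> b))) \<partial>(lborel :: complex measure))"
    by (simp add: cgauss_def emeasure_density cgauss_density_eq_normal[OF assms] prod_ennreal)
  also have "\<dots> = (\<Prod>b\<in>(Basis :: complex set). \<integral>\<^sup>+x. ennreal (normal_density 0 (sqrt (v / 2)) x) \<partial>lborel)"
    by (rule nn_integral_lborel_prod) auto
  also have "\<dots> = 1"
    using assms by (simp add: nn_integral_eq_integral)
  finally show "emeasure (cgauss v) (space (cgauss v)) = 1" .
qed

abbreviation "std_cgauss \<equiv> cgauss 1"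

interpretation std_cgauss: prob_space std_cgauss
  by (rule prob_space_cgauss) simp

lemma nn_integral_cgauss:
  "f \<in> borel_measurable borel \<Longrightarrow>
    integral\<^sup>N (cgauss v) f = (\<integral>\<^sup>+z. ennreal (cgauss_density v z) * f z \<partial>lborel)"
  unfolding cgauss_def by (subst nn_integral_density) auto

lemma nn_integral_cgauss_unit_mult:
  fixes f :: "complex \<Rightarrow> ennreal"
  assumes [measurable]: "f \<in> borel_measurable borel" and e: "cmod e = 1"
  shows "(\<integral>\<^sup>+z. f (e * z) \<partial>cgauss v) = integral\<^sup>N (cgauss v) f"
proof -
  have "cgauss_density v (e * z) = cgauss_density v z" for z
    using e by (simp add: cgauss_density_def norm_mult)
  then show ?thesis
    using nn_integral_lborel_unit_mult[of "\<lambda>z. ennreal (cgauss_density v z) * f z" e] e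
    by (simp add: nn_integral_cgauss)
qed

lemma norm_reflection:
  fixes y w :: "'a::real_inner"
  assumes "a\<^sup>2 + b\<^sup>2 = 1"
  shows "(norm (a *\<^sub>R y + b *\<^sub>R w))\<^sup>2 + (norm (b *\<^sub>R y - a *\<^sub>R w))\<^sup>2 = (norm y)\<^sup>2 + (norm w)\<^sup>2"
proof -
  have "(norm (a *\<^sub>R y + b *\<^sub>R w))\<^sup>2 + (norm (b *\<^sub>R y - a *\<^sub>R w))\<^sup>2 =
    (a\<^sup>2 + b\<^sup>2) * ((norm y)\<^sup>2 + (norm w)\<^sup>2)"
    unfolding power2_norm_eq_inner by (simp add: inner_simps inner_commute power2_eq_square algebra_simps)
  then show ?thesis using assms by simp
qed

text \<open>The product of the two Gaussian densities depends only on the sum of the squared norms,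
  which the reflection preserves, so Lebesgue invariance carries over.\<close>

lemma nn_integral_std_cgauss_reflection:
  fixes f :: "complex \<times> complex \<Rightarrow> ennreal"
  assumes [measurable]: "f \<in> borel_measurable (borel \<Otimes>\<^sub>M borel)" and ab: "a\<^sup>2 + b\<^sup>2 = 1"
  shows "(\<integral>\<^sup>+y. \<integral>\<^sup>+w. f (a *\<^sub>R y + b *\<^sub>R w, b *\<^sub>R y - a *\<^sub>R w) \<partial>std_cgauss \<partial>std_cgauss) =
    (\<integral>\<^sup>+y. \<integral>\<^sup>+w. f (y, w) \<partial>std_cgauss \<partial>std_cgauss)"
proof -
  let ?d = "\<lambda>y. ennreal (cgauss_density 1 y)"
  have iter: "(\<integral>\<^sup>+y. \<integral>\<^sup>+w. h (y, w) \<partial>std_cgauss \<partial>std_cgauss) =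
      (\<integral>\<^sup>+y. \<integral>\<^sup>+w. ?d y * ?d w * h (y, w) \<partial>lborel \<partial>lborel)"
    if [measurable]: "h \<in> borel_measurable (borel \<Otimes>\<^sub>M borel)" for h :: "complex \<times> complex \<Rightarrow> ennreal"
  proof -
    have "(\<integral>\<^sup>+y. \<integral>\<^sup>+w. h (y, w) \<partial>std_cgauss \<partial>std_cgauss) =
      (\<integral>\<^sup>+y. \<integral>\<^sup>+w. ?d w * h (y, w) \<partial>lborel \<partial>std_cgauss)"
      by (intro nn_integral_cong nn_integral_cgauss) measurable
    also have "\<dots> = (\<integral>\<^sup>+y. ?d y * (\<integral>\<^sup>+w. ?d w * h (y, w) \<partial>lborel) \<partial>lborel)"
      by (rule nn_integral_cgauss) measurable
    also have "\<dots> = (\<integral>\<^sup>+y. \<integral>\<^sup>+w. ?d y * ?d w * h (y, w) \<partial>lborel \<partial>lborel)"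
      by (rule nn_integral_cong) (simp add: nn_integral_cmult[symmetric] mult.assoc)
    finally show ?thesis .
  qed
  have d: "?d (a *\<^sub>R y + b *\<^sub>R w) * ?d (b *\<^sub>R y - a *\<^sub>R w) = ?d y * ?d w" for y w :: complex
    using norm_reflection[OF ab, of y w]
    by (simp add: cgauss_density_def ennreal_mult[symmetric] exp_add[symmetric])
  have "(\<integral>\<^sup>+y. \<integral>\<^sup>+w. f (a *\<^sub>R y + b *\<^sub>R w, b *\<^sub>R y - a *\<^sub>R w) \<partial>std_cgauss \<partial>std_cgauss) =
    (\<integral>\<^sup>+y. \<integral>\<^sup>+w. ?d y * ?d w * f (a *\<^sub>R y + b *\<^sub>R w, b *\<^sub>R y - a *\<^sub>R w) \<partial>lborel \<partial>lborel)"
    using iter[of "\<lambda>p. f (a *\<^sub>R fst p + b *\<^sub>R snd p, b *\<^sub>R fst p - a *\<^sub>R snd p)"] by simp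
  also have "\<dots> = (\<integral>\<^sup>+y. \<integral>\<^sup>+w. ?d y * ?d w * f (y, w) \<partial>lborel \<partial>lborel)"
    using nn_integral_lborel_reflection[of "\<lambda>p. ?d (fst p) * ?d (snd p) * f p", OF _ ab] by (simp add: d)
  also have "\<dots> = (\<integral>\<^sup>+y. \<integral>\<^sup>+w. f (y, w) \<partial>std_cgauss \<partial>std_cgauss)"
    by (rule iter[symmetric]) measurable
  finally show ?thesis .
qed

text \<open>The phase of \<open>c\<close> is absorbed by rotation invariance. With \<open>r\<close>
  the square root on the right, the remaining real combination is \<open>r\<close> times the first
  coordinate of a reflection of the pair, so it is distributed like \<open>r\<close> times one
  standard Gaussian.\<close>

lemma nn_integral_std_cgauss_add:
  fixes f :: "complex \<Rightarrow> ennreal" and c :: complex and t :: real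
  assumes [measurable]: "f \<in> borel_measurable borel"
  shows "(\<integral>\<^sup>+z. \<integral>\<^sup>+y. f (t *\<^sub>R z + c * y) \<partial>std_cgauss \<partial>std_cgauss) =
    (\<integral>\<^sup>+z. f (sqrt (t\<^sup>2 + (cmod c)\<^sup>2) *\<^sub>R z) \<partial>std_cgauss)"
proof (cases "t\<^sup>2 + (cmod c)\<^sup>2 = 0")
  case True
  then have "t = 0" "c = 0" by (auto simp: sum_power2_eq_zero_iff)
  then show ?thesis using std_cgauss.emeasure_space_1 by simp
next
  case False
  define r where "r = sqrt (t\<^sup>2 + (cmod c)\<^sup>2)"
  have r: "r > 0" "r\<^sup>2 = t\<^sup>2 + (cmod c)\<^sup>2"
    using False by (auto simp: r_def sum_power2_gt_zero_iff sum_power2_eq_zero_iff)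
  have "\<exists>e. cmod e = 1 \<and> c = e * cmod c"
  proof (cases "c = 0")
    case False
    then show ?thesis by (intro exI[of _ "c / cmod c"]) (simp add: norm_divide)
  qed (auto intro!: exI[of _ 1])
  then obtain e where e: "cmod e = 1" "c = e * cmod c" by blast
  have "(\<integral>\<^sup>+y. f (t *\<^sub>R z + c * y) \<partial>std_cgauss) = (\<integral>\<^sup>+y. f (t *\<^sub>R z + cmod c *\<^sub>R y) \<partial>std_cgauss)" for z
  proof -
    have "c * y = cmod c *\<^sub>R (e * y)" for y
      by (subst e(2)) (simp add: scaleR_conv_of_real)
    then show ?thesis
      using nn_integral_cgauss_unit_mult[of "\<lambda>y. f (t *\<^sub>R z + cmod c *\<^sub>R y)" e 1] e by simp
  qed
  moreover have "t *\<^sub>R z + cmod c *\<^sub>R y = r *\<^sub>R ((t / r) *\<^sub>R z + (cmod c / r) *\<^sub>R y)" for z y :: complex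
    using r by (simp add: algebra_simps)
  moreover have "(t / r)\<^sup>2 + (cmod c / r)\<^sup>2 = 1"
    using r False by (auto simp: power_divide add_divide_distrib[symmetric])
  ultimately have "(\<integral>\<^sup>+z. \<integral>\<^sup>+y. f (t *\<^sub>R z + c * y) \<partial>std_cgauss \<partial>std_cgauss) =
      (\<integral>\<^sup>+z. \<integral>\<^sup>+y. f (r *\<^sub>R z) \<partial>std_cgauss \<partial>std_cgauss)"
    using nn_integral_std_cgauss_reflection[of "\<lambda>p. f (r *\<^sub>R fst p)" "t / r" "cmod c / r"] by simp
  then show ?thesis using std_cgauss.emeasure_space_1 by (simp add: r_def)
qed

text \<open>Each induction step merges one more coordinate with the Gaussian that stands for the
  partial sum. The function \<open>f\<close> must stay general, since the hypothesis is applied to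
  its average over the new coordinate.\<close>

lemma nn_integral_PiM_std_cgauss_sum:
  fixes f :: "complex \<Rightarrow> ennreal" and c :: "'i \<Rightarrow> complex"
  assumes "finite I" and "f \<in> borel_measurable borel"
  shows "(\<integral>\<^sup>+x. f (\<Sum>i\<in>I. c i * x i) \<partial>PiM I (\<lambda>_. std_cgauss)) =
    (\<integral>\<^sup>+z. f (sqrt (\<Sum>i\<in>I. (cmod (c i))\<^sup>2) *\<^sub>R z) \<partial>std_cgauss)"
  using assms
proof (induction I arbitrary: f rule: finite_induct)
  case empty
  then show ?case
    using std_cgauss.emeasure_space_1 by (simp add: PiM_empty nn_integral_count_space_finite)
next
  case (insert i I)
  note [measurable] = insert.prems
  interpret product_sigma_finite "\<lambda>_. std_cgauss" by standard
  have "(\<integral>\<^sup>+x. f (\<Sum>j\<in>insert i I. c j * x j) \<partial>PiM (insert i I) (\<lambda>_. std_cgauss)) =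
    (\<integral>\<^sup>+x. \<integral>\<^sup>+y. f (\<Sum>j\<in>insert i I. c j * (x(i := y)) j) \<partial>std_cgauss \<partial>PiM I (\<lambda>_. std_cgauss))"
    by (rule product_nn_integral_insert[OF insert.hyps(1,2)]) measurable
  also have "\<dots> = (\<integral>\<^sup>+x. (\<lambda>s. \<integral>\<^sup>+y. f (s + c i * y) \<partial>std_cgauss) (\<Sum>j\<in>I. c j * x j) \<partial>PiM I (\<lambda>_. std_cgauss))"
  proof -
    have "(\<Sum>j\<in>insert i I. c j * (x(i := y)) j) = (\<Sum>j\<in>I. c j * x j) + c i * y" for x y
    proof -
      have "(\<Sum>j\<in>I. c j * (x(i := y)) j) = (\<Sum>j\<in>I. c j * x j)"
        by (rule sum.cong) (use insert.hyps in auto)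
      then show ?thesis using insert.hyps by simp
    qed
    then show ?thesis by simp
  qed
  also have "\<dots> = (\<integral>\<^sup>+z. \<integral>\<^sup>+y. f (sqrt (\<Sum>j\<in>I. (cmod (c j))\<^sup>2) *\<^sub>R z + c i * y) \<partial>std_cgauss \<partial>std_cgauss)"
    by (rule insert.IH) measurable
  also have "\<dots> = (\<integral>\<^sup>+z. f (sqrt (\<Sum>j\<in>insert i I. (cmod (c j))\<^sup>2) *\<^sub>R z) \<partial>std_cgauss)"
    using nn_integral_std_cgauss_add[OF insert.prems, of "sqrt (\<Sum>j\<in>I. (cmod (c j))\<^sup>2)" "c i"] insert.hyps
    by (simp add: sum_nonneg add.commute)
  finally show ?case .
qed

section \<open>Noise vectors as products of scalar Gaussians\<close>

lemma measurable_vec_lambda [measurable]: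
  "vec_lambda \<in> PiM UNIV (\<lambda>_. borel) \<rightarrow>\<^sub>M (borel :: ('a::euclidean_space ^ 'n::finite) measure)"
proof (subst borel_measurable_euclidean_space, intro ballI)
  fix b :: "'a ^ 'n" assume "b \<in> Basis"
  then obtain i u where b: "b = axis i u" by (auto simp: Basis_vec_def)
  show "(\<lambda>x. vec_lambda x \<bullet> b) \<in> borel_measurable (PiM UNIV (\<lambda>_. borel))"
    unfolding b inner_axis vec_lambda_beta by measurable
qed

lemma measurable_vec_nth_euclidean [measurable]:
  "(\<lambda>x. x $ i) \<in> (borel :: ('a::euclidean_space ^ 'n::finite) measure) \<rightarrow>\<^sub>M borel"
  by (intro borel_measurable_continuous_onI continuous_intros)

lemma prod_Basis_vec:
  "(\<Prod>b\<in>(Basis :: ('a::euclidean_space ^ 'n::finite) set). f b) = (\<Prod>i\<in>UNIV. \<Prod>u\<in>Basis. f (axis i u))"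
proof -
  have B: "(Basis :: ('a ^ 'n) set) = (\<lambda>(i, u). axis i u) ` (UNIV \<times> Basis)"
    by (auto simp: Basis_vec_def)
  have inj: "inj_on (\<lambda>(i, u). axis i u :: 'a ^ 'n) (UNIV \<times> Basis)"
    by (auto simp: inj_on_def axis_eq_axis)
  have "(\<Prod>b\<in>(Basis :: ('a ^ 'n) set). f b) = (\<Prod>p\<in>UNIV \<times> Basis. f (axis (fst p) (snd p)))"
    by (subst B, subst prod.reindex[OF inj]) (simp add: split_def)
  then show ?thesis by (simp add: prod.cartesian_product split_def)
qed

lemma lborel_vec_eq:
  "(lborel :: ('a::euclidean_space ^ 'n::finite) measure) = distr (PiM UNIV (\<lambda>_. lborel)) borel vec_lambda"
proof (rule lborel_eqI)
  interpret product_sigma_finite "\<lambda>_::'n. lborel :: 'a measure" by standard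
  fix l u :: "'a ^ 'n"
  assume "\<And>b. b \<in> Basis \<Longrightarrow> l \<bullet> b \<le> u \<bullet> b"
  then have le: "v \<in> Basis \<Longrightarrow> l $ i \<bullet> v \<le> u $ i \<bullet> v" for i v
    by (metis axis_in_Basis_iff inner_axis)
  have "vec_lambda -` box l u = PiE UNIV (\<lambda>i. box (l $ i) (u $ i))"
    by (auto simp: box_def Basis_vec_def inner_axis)
  then have "emeasure (distr (PiM UNIV (\<lambda>_. lborel)) borel vec_lambda) (box l u) =
      (\<Prod>i\<in>UNIV. ennreal (\<Prod>v\<in>Basis. (u $ i - l $ i) \<bullet> v))"
    by (subst emeasure_distr) (simp_all add: space_PiM emeasure_PiM le)
  also have "\<dots> = ennreal (\<Prod>b\<in>Basis. (u - l) \<bullet> b)"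
    by (subst prod_ennreal) (auto intro!: prod_nonneg simp: le prod_Basis_vec inner_axis inner_diff_left)
  finally show "emeasure (distr (PiM UNIV (\<lambda>_. lborel)) borel vec_lambda) (box l u) =
      ennreal (\<Prod>b\<in>Basis. (u - l) \<bullet> b)" .
qed simp

lemma PiM_cgauss_eq_density:
  assumes v: "v > 0" and I: "finite I"
  shows "PiM I (\<lambda>_. cgauss v) = density (PiM I (\<lambda>_. lborel)) (\<lambda>x. \<Prod>i\<in>I. ennreal (cgauss_density v (x i)))"
proof -
  interpret G: prob_space "cgauss v" by (rule prob_space_cgauss[OF v])
  interpret product_sigma_finite "\<lambda>_. cgauss v" by standard
  interpret L: product_sigma_finite "\<lambda>_. lborel :: complex measure" by standard
  show ?thesis
  proof (rule PiM_eqI[OF I, symmetric])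
    have "sets (PiM I (\<lambda>_. lborel :: complex measure)) = sets (PiM I (\<lambda>_. cgauss v))"
      by (intro sets_PiM_cong) auto
    then show "sets (density (PiM I (\<lambda>_. lborel)) (\<lambda>x. \<Prod>i\<in>I. ennreal (cgauss_density v (x i)))) =
        sets (PiM I (\<lambda>_. cgauss v))"
      by simp
    fix A :: "'a \<Rightarrow> complex set" assume A: "\<And>i. i \<in> I \<Longrightarrow> A i \<in> sets (cgauss v)"
    then have [measurable]: "PiE I A \<in> sets (PiM I (\<lambda>_. lborel))"
      using I by (intro sets_PiM_I_finite) auto
    have "emeasure (density (PiM I (\<lambda>_. lborel)) (\<lambda>x. \<Prod>i\<in>I. ennreal (cgauss_density v (x i)))) (PiE I A) =
      (\<integral>\<^sup>+x. (\<Prod>i\<in>I. ennreal (cgauss_density v (x i))) * indicator (PiE I A) x \<partial>PiM I (\<lambda>_. lborel))"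
      by (subst emeasure_density) auto
    also have "\<dots> = (\<integral>\<^sup>+x. (\<Prod>i\<in>I. ennreal (cgauss_density v (x i)) * indicator (A i) (x i)) \<partial>PiM I (\<lambda>_. lborel))"
    proof (rule nn_integral_cong)
      fix x :: "'a \<Rightarrow> complex" assume "x \<in> space (PiM I (\<lambda>_. lborel))"
      then have "indicator (PiE I A) x = (\<Prod>i\<in>I. indicator (A i) (x i) :: ennreal)"
        using I by (auto simp: space_PiM PiE_iff indicator_def prod.If_cases split: if_splits)
      then show "(\<Prod>i\<in>I. ennreal (cgauss_density v (x i))) * indicator (PiE I A) x =
          (\<Prod>i\<in>I. ennreal (cgauss_density v (x i)) * indicator (A i) (x i))"
        by (simp add: prod.distrib)
    qed
    also have "\<dots> = (\<Prod>i\<in>I. \<integral>\<^sup>+x. ennreal (cgauss_density v x) * indicator (A i) x \<partial>lborel)"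
      using I A by (intro L.product_nn_integral_prod) auto
    also have "\<dots> = (\<Prod>i\<in>I. emeasure (cgauss v) (A i))"
      using A by (intro prod.cong refl) (simp add: cgauss_def emeasure_density)
    finally show "emeasure (density (PiM I (\<lambda>_. lborel)) (\<lambda>x. \<Prod>i\<in>I. ennreal (cgauss_density v (x i)))) (PiE I A) =
        (\<Prod>i\<in>I. emeasure (cgauss v) (A i))" .
  qed
qed

text \<open>The product form makes the induction over coordinates in
  \<open>nn_integral_PiM_std_cgauss_sum\<close> available for noise vectors; the density form
  remains the one suited to translations.\<close>

lemma cgauss_noise_eq_PiM:
  "(cgauss_noise :: (complex ^ 'n::finite) measure) = distr (PiM UNIV (\<lambda>_. std_cgauss)) borel vec_lambda"
proof -
  have "(cgauss_noise :: (complex ^ 'n) measure) = distr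
      (density (PiM UNIV (\<lambda>_. lborel)) (\<lambda>x. \<Prod>i\<in>UNIV. ennreal (cgauss_density 1 (x i)))) borel vec_lambda"
  proof (rule measure_eqI)
    fix A :: "(complex ^ 'n) set" assume "A \<in> sets cgauss_noise"
    then have [measurable]: "A \<in> sets borel" by (simp add: cgauss_noise_def)
    have "emeasure cgauss_noise A =
      (\<integral>\<^sup>+w. ennreal (\<Prod>i\<in>UNIV. cgauss_density 1 (w $ i)) * indicator A w \<partial>distr (PiM UNIV (\<lambda>_. lborel)) borel vec_lambda)"
      by (simp add: cgauss_noise_def emeasure_density lborel_vec_eq[symmetric])
    also have "\<dots> = (\<integral>\<^sup>+x. (\<Prod>i\<in>UNIV. ennreal (cgauss_density 1 (x i))) * indicator A (vec_lambda x) \<partial>PiM UNIV (\<lambda>_. lborel))"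
      by (subst nn_integral_distr) (auto simp: prod_ennreal cgauss_density_nonneg)
    also have "\<dots> = (\<integral>\<^sup>+x. indicator A (vec_lambda x) \<partial>
        density (PiM UNIV (\<lambda>_. lborel)) (\<lambda>x. \<Prod>i\<in>UNIV. ennreal (cgauss_density 1 (x i))))"
      by (subst nn_integral_density) auto
    also have "\<dots> = (\<integral>\<^sup>+w. indicator A w \<partial>distr
        (density (PiM UNIV (\<lambda>_. lborel)) (\<lambda>x. \<Prod>i\<in>UNIV. ennreal (cgauss_density 1 (x i)))) borel vec_lambda)"
      by (subst nn_integral_distr) auto
    finally show "emeasure cgauss_noise A = emeasure (distr
      (density (PiM UNIV (\<lambda>_. lborel)) (\<lambda>x. \<Prod>i\<in>UNIV. ennreal (cgauss_density 1 (x i)))) borel vec_lambda) A"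
      by simp
  qed (simp add: cgauss_noise_def)
  then show ?thesis by (simp add: PiM_cgauss_eq_density)
qed

lemma sets_cgauss_noise [measurable_cong, simp]: "sets cgauss_noise = sets borel"
  by (simp add: cgauss_noise_def)

lemma space_cgauss_noise [simp]: "space cgauss_noise = UNIV"
  by (simp add: cgauss_noise_def)

lemma measurable_vec_lambda_cgauss [measurable]:
  "vec_lambda \<in> PiM UNIV (\<lambda>_. cgauss v) \<rightarrow>\<^sub>M (borel :: (complex ^ 'n::finite) measure)"
  using measurable_vec_lambda by (subst measurable_cong_sets[OF sets_PiM_cong refl]) auto

lemma prob_space_cgauss_noise: "prob_space (cgauss_noise :: (complex ^ 'n::finite) measure)"
proof -
  interpret product_prob_space "\<lambda>_::'n. std_cgauss" by standard
  have "prob_space (PiM UNIV (\<lambda>_::'n. std_cgauss))" by (rule prob_space_PiM) (rule std_cgauss.prob_space_axioms)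
  then show ?thesis
    unfolding cgauss_noise_eq_PiM by (rule prob_space.prob_space_distr) measurable
qed

lemma nn_integral_cgauss_noise_sum:
  fixes f :: "complex \<Rightarrow> ennreal" and c :: "'n::finite \<Rightarrow> complex"
  assumes [measurable]: "f \<in> borel_measurable borel" and c: "(\<Sum>i\<in>UNIV. (cmod (c i))\<^sup>2) = 1"
  shows "(\<integral>\<^sup>+w. f (\<Sum>i\<in>UNIV. c i * w $ i) \<partial>cgauss_noise) = integral\<^sup>N std_cgauss f"
  unfolding cgauss_noise_eq_PiM
  by (subst nn_integral_distr) (simp_all add: nn_integral_PiM_std_cgauss_sum c)

section \<open>Likelihood ratios\<close>

text \<open>The density of \<open>n x + w\<close>, for \<open>w\<close> standard complex Gaussian, relative to the law of \<open>w\<close>.\<close>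

definition lik :: "real \<Rightarrow> complex \<Rightarrow> complex \<Rightarrow> real" where
  "lik n x y = exp (2 * n * (x \<bullet> y) - n\<^sup>2 * (cmod x)\<^sup>2)"

lemma lik_pos [simp]: "0 < lik n x y"
  by (simp add: lik_def)

lemma lik_nonneg [simp]: "0 \<le> lik n x y"
  by (simp add: lik_def)

lemma lik_neq_0 [simp]: "lik n x y \<noteq> 0"
  by (simp add: lik_def)

lemma lik_0 [simp]: "lik 0 x y = 1"
  by (simp add: lik_def)

lemma borel_measurable_lik [measurable (raw)]:
  assumes [measurable]: "f \<in> M \<rightarrow>\<^sub>M borel" "g \<in> M \<rightarrow>\<^sub>M borel"
  shows "(\<lambda>z. lik n (f z) (g z)) \<in> borel_measurable M"
  unfolding lik_def by measurable

text \<open>The square of \<open>norm (n x - y)\<close> is nonnegative. Since the bound is free of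
  \<open>x\<close>, the likelihood at a fixed \<open>y\<close> is integrable under every input
  law.\<close>

lemma lik_le: "lik n x y \<le> exp ((cmod y)\<^sup>2)"
proof -
  have "0 \<le> (norm (n *\<^sub>R x - y))\<^sup>2" by simp
  also have "\<dots> = n\<^sup>2 * (cmod x)\<^sup>2 - 2 * n * (x \<bullet> y) + (cmod y)\<^sup>2"
    unfolding power2_norm_eq_inner
    by (simp add: inner_simps inner_commute power2_eq_square algebra_simps)
  finally show ?thesis by (simp add: lik_def)
qed

text \<open>The squared gain splits as \<open>n^2 = (n a)^2 + (n b)^2\<close>. The factor in
  \<open>w\<close> has noise integral 1, so averaging over \<open>w\<close> leaves the likelihood of
  gain \<open>n * a\<close>: this identity is the analytic form of degradation.\<close>

lemma lik_reflection:
  assumes "a\<^sup>2 + b\<^sup>2 = 1"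
  shows "lik n x (a *\<^sub>R y + b *\<^sub>R w) = lik (n * a) x y * lik (n * b) x w"
proof -
  have "n\<^sup>2 * (cmod x)\<^sup>2 = (n * a)\<^sup>2 * (cmod x)\<^sup>2 + (n * b)\<^sup>2 * (cmod x)\<^sup>2"
    using assms by (simp add: power_mult_distrib distrib_left[symmetric] distrib_right[symmetric])
  then show ?thesis
    by (simp add: lik_def exp_add[symmetric] inner_simps algebra_simps)
qed

text \<open>This is the finite-dimensional Cameron-Martin formula: \<open>lik\<close> is the
  quotient of the shifted and the unshifted Gaussian density.\<close>

lemma nn_integral_std_cgauss_translate:
  assumes [measurable]: "f \<in> borel_measurable borel"
  shows "(\<integral>\<^sup>+w. f (n *\<^sub>R x + w) \<partial>std_cgauss) = (\<integral>\<^sup>+y. ennreal (lik n x y) * f y \<partial>std_cgauss)"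
proof -
  have d: "cgauss_density 1 y = cgauss_density 1 (n *\<^sub>R x + y) * lik n x (n *\<^sub>R x + y)" for y
  proof -
    have "(norm (n *\<^sub>R x + y))\<^sup>2 = 2 * n * (x \<bullet> (n *\<^sub>R x + y)) - n\<^sup>2 * (norm x)\<^sup>2 + (norm y)\<^sup>2"
      unfolding power2_norm_eq_inner
      by (simp add: inner_simps inner_commute power2_eq_square algebra_simps)
    then show ?thesis by (simp add: cgauss_density_def lik_def exp_add[symmetric])
  qed
  have "(\<integral>\<^sup>+w. f (n *\<^sub>R x + w) \<partial>std_cgauss) =
      (\<integral>\<^sup>+w. ennreal (cgauss_density 1 (n *\<^sub>R x + w) * lik n x (n *\<^sub>R x + w)) * f (n *\<^sub>R x + w) \<partial>lborel)"
    by (subst nn_integral_cgauss) (simp_all add: d[symmetric])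
  also have "\<dots> = (\<integral>\<^sup>+w. ennreal (cgauss_density 1 w * lik n x w) * f w \<partial>lborel)"
    using nn_integral_lborel_translate[of "\<lambda>w. ennreal (cgauss_density 1 w * lik n x w) * f w" "n *\<^sub>R x"] by simp
  also have "\<dots> = (\<integral>\<^sup>+y. ennreal (lik n x y) * f y \<partial>std_cgauss)"
    by (subst nn_integral_cgauss) (simp_all add: ennreal_mult cgauss_density_nonneg mult.assoc)
  finally show ?thesis .
qed

lemma nn_integral_lik [simp]: "(\<integral>\<^sup>+y. ennreal (lik n x y) \<partial>std_cgauss) = 1"
  using nn_integral_std_cgauss_translate[of "\<lambda>_. 1" n x] std_cgauss.emeasure_space_1 by simp

text \<open>In the exponent the vector \<open>w\<close> appears only through its inner product with
  \<open>x *s h\<close>, which is \<open>norm h\<close> times the inner product of \<open>x\<close>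
  with one scalar combination of the entries of \<open>w\<close>. That is the sufficiency of the
  projection. The coefficients are constrained through \<open>norm h * c i\<close>, which makes
  sense for \<open>h = 0\<close> too.\<close>

lemma nn_integral_cgauss_noise_translate:
  fixes h :: "complex ^ 'n::finite" and c :: "'n \<Rightarrow> complex"
  assumes [measurable]: "f \<in> borel_measurable borel"
    and c: "\<And>i. of_real (norm h) * c i = cnj (h $ i)"
  shows "(\<integral>\<^sup>+w. f (x *s h + w) \<partial>cgauss_noise) =
    (\<integral>\<^sup>+w. ennreal (lik (norm h) x (\<Sum>i\<in>UNIV. c i * w $ i)) * f w \<partial>cgauss_noise)"
proof -
  let ?d = "\<lambda>w :: complex ^ 'n. \<Prod>i\<in>UNIV. cgauss_density 1 (w $ i)"
  let ?s = "\<lambda>w :: complex ^ 'n. \<Sum>i\<in>UNIV. c i * w $ i"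
  have d_nonneg: "0 \<le> ?d w" for w by (intro prod_nonneg) (simp add: cgauss_density_nonneg)
  have nh: "(norm h)\<^sup>2 = (\<Sum>i\<in>UNIV. (cmod (h $ i))\<^sup>2)"
    by (simp add: norm_vec_def L2_set_def sum_nonneg)
  have d: "?d w = ?d (x *s h + w) * lik (norm h) x (?s (x *s h + w))" for w
  proof -
    let ?v = "x *s h + w"
    have "norm h * (x \<bullet> ?s ?v) = (\<Sum>i\<in>UNIV. (x * h $ i) \<bullet> (?v $ i))"
    proof -
      have "norm h * (x \<bullet> ?s ?v) = x \<bullet> (of_real (norm h) * ?s ?v)"
        by (simp add: scaleR_conv_of_real[symmetric])
      also have "of_real (norm h) * ?s ?v = (\<Sum>i\<in>UNIV. cnj (h $ i) * ?v $ i)"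
        by (simp only: sum_distrib_left mult.assoc[symmetric] c)
      also have "x \<bullet> \<dots> = (\<Sum>i\<in>UNIV. (x * h $ i) \<bullet> (?v $ i))"
        by (subst inner_sum_right, intro sum.cong refl) (simp add: inner_complex_def algebra_simps)
      finally show ?thesis .
    qed
    moreover have "(cmod (x * h $ i + w $ i))\<^sup>2 =
        2 * ((x * h $ i) \<bullet> (x * h $ i + w $ i)) - (cmod x)\<^sup>2 * (cmod (h $ i))\<^sup>2 + (cmod (w $ i))\<^sup>2" for i
    proof -
      have "(cmod (x * h $ i + w $ i))\<^sup>2 =
          2 * ((x * h $ i) \<bullet> (x * h $ i + w $ i)) - (cmod (x * h $ i))\<^sup>2 + (cmod (w $ i))\<^sup>2"
        unfolding power2_norm_eq_inner by (simp add: inner_simps inner_commute algebra_simps)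
      then show ?thesis by (simp add: norm_mult power_mult_distrib)
    qed
    ultimately have S: "(\<Sum>i\<in>UNIV. (cmod (?v $ i))\<^sup>2) =
        2 * norm h * (x \<bullet> ?s ?v) - (norm h)\<^sup>2 * (cmod x)\<^sup>2 + (\<Sum>i\<in>UNIV. (cmod (w $ i))\<^sup>2)"
    proof -
      assume 1: "norm h * (x \<bullet> ?s ?v) = (\<Sum>i\<in>UNIV. (x * h $ i) \<bullet> (?v $ i))"
        and 2: "\<And>i. (cmod (x * h $ i + w $ i))\<^sup>2 =
          2 * ((x * h $ i) \<bullet> (x * h $ i + w $ i)) - (cmod x)\<^sup>2 * (cmod (h $ i))\<^sup>2 + (cmod (w $ i))\<^sup>2"
      have "(\<Sum>i\<in>UNIV. (cmod (?v $ i))\<^sup>2) = 2 * (\<Sum>i\<in>UNIV. (x * h $ i) \<bullet> (?v $ i)) -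
          (cmod x)\<^sup>2 * (\<Sum>i\<in>UNIV. (cmod (h $ i))\<^sup>2) + (\<Sum>i\<in>UNIV. (cmod (w $ i))\<^sup>2)"
        by (simp add: 2 sum.distrib sum_subtractf sum_distrib_left)
      then show ?thesis using 1 by (simp add: nh)
    qed
    have E: "?d u = exp (- (\<Sum>i\<in>UNIV. (cmod (u $ i))\<^sup>2)) / pi ^ CARD('n)" for u :: "complex ^ 'n"
      by (simp add: cgauss_density_def prod_dividef exp_sum[symmetric] sum_negf[symmetric])
    show ?thesis unfolding E S by (simp add: lik_def exp_add[symmetric])
  qed
  have int: "integral\<^sup>N cgauss_noise g = (\<integral>\<^sup>+w. ennreal (?d w) * g w \<partial>lborel)"
    if [measurable]: "g \<in> borel_measurable borel" for g :: "complex ^ 'n \<Rightarrow> ennreal"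
    unfolding cgauss_noise_def by (subst nn_integral_density) auto
  have "(\<integral>\<^sup>+w. f (x *s h + w) \<partial>cgauss_noise) =
      (\<integral>\<^sup>+w. ennreal (?d (x *s h + w) * lik (norm h) x (?s (x *s h + w))) * f (x *s h + w) \<partial>lborel)"
    by (subst int) (simp_all only: d[symmetric], measurable)
  also have "\<dots> = (\<integral>\<^sup>+w. ennreal (?d w * lik (norm h) x (?s w)) * f w \<partial>lborel)"
    by (rule nn_integral_lborel_translate[symmetric]) measurable
  also have "\<dots> = (\<integral>\<^sup>+w. ennreal (lik (norm h) x (?s w)) * f w \<partial>cgauss_noise)"
    by (subst int) (simp_all add: ennreal_mult d_nonneg mult.assoc)
  finally show ?thesis .
qed

lemma exists_conjugate_direction:
  fixes h :: "complex ^ 'n::finite"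
  obtains c :: "'n \<Rightarrow> complex"
  where "(\<Sum>i\<in>UNIV. (cmod (c i))\<^sup>2) = 1" "\<And>i. of_real (norm h) * c i = cnj (h $ i)"
proof (cases "h = 0")
  case True
  \<comment> \<open>For \<open>h = 0\<close> every unit vector meets the second condition;
    \<open>undefined\<close> merely names one coordinate.\<close>
  let ?c = "\<lambda>i::'n. if i = undefined then 1 else 0 :: complex"
  have "(\<Sum>i\<in>UNIV. (cmod (?c i))\<^sup>2) = (\<Sum>i\<in>UNIV. if i = (undefined :: 'n) then 1 else 0 :: real)"
    by (rule sum.cong) auto
  then show ?thesis using True by (intro that[of ?c]) simp_all
next
  case False
  have "(norm h)\<^sup>2 = (\<Sum>i\<in>UNIV. (cmod (h $ i))\<^sup>2)"
    by (simp add: norm_vec_def L2_set_def sum_nonneg)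
  moreover from this have "(\<Sum>i\<in>UNIV. (cmod (h $ i))\<^sup>2) \<noteq> 0"
    using False by (metis norm_eq_zero power_eq_0_iff)
  ultimately show ?thesis using False
    by (intro that[of "\<lambda>i. cnj (h $ i) / of_real (norm h)"])
       (simp_all add: norm_divide power_divide sum_divide_distrib[symmetric])
qed

text \<open>Conditional expectation given \<open>T\<close>, as a function of the value of \<open>T\<close>.\<close>

lemma exists_conditional_density:
  fixes F :: "'a \<Rightarrow> real"
  assumes "prob_space N" and [measurable]: "T \<in> N \<rightarrow>\<^sub>M K" "F \<in> borel_measurable N"
    and F: "(\<integral>\<^sup>+x. ennreal (F x) \<partial>N) = 1"
  obtains D :: "'b \<Rightarrow> real" where "D \<in> borel_measurable K" "\<And>z. 0 \<le> D z"
    "\<And>f. f \<in> borel_measurable K \<Longrightarrow>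
      (\<integral>\<^sup>+x. ennreal (F x) * f (T x) \<partial>N) = (\<integral>\<^sup>+x. ennreal (D (T x)) * f (T x) \<partial>N)"
proof -
  interpret prob_space N by fact
  \<comment> \<open>Both measures are pushed forward to \<open>K\<close> before differentiating, so
    the derivative is a function of the value of \<open>T\<close> from the start.\<close>
  define \<nu> where "\<nu> = distr N K T"
  define \<mu> where "\<mu> = distr (density N (\<lambda>x. ennreal (F x))) K T"
  interpret \<nu>: prob_space \<nu> unfolding \<nu>_def by (rule prob_space_distr) measurable
  have sets: "sets \<mu> = sets \<nu>" by (simp add: \<mu>_def \<nu>_def)
  have "finite_measure \<mu>"
  proof
    have "emeasure \<mu> (space \<mu>) = (\<integral>\<^sup>+x. ennreal (F x) * indicator (T -` space K \<inter> space N) x \<partial>N)"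
      by (simp add: \<mu>_def emeasure_distr emeasure_density)
    also have "\<dots> = (\<integral>\<^sup>+x. ennreal (F x) \<partial>N)"
      by (rule nn_integral_cong) (auto simp: measurable_space[OF assms(2)] indicator_def)
    finally have "emeasure \<mu> (space \<mu>) = 1" using F by simp
    then show "emeasure \<mu> (space \<mu>) \<noteq> \<infinity>" by simp
  qed
  have ac: "absolutely_continuous \<nu> \<mu>"
    unfolding absolutely_continuous_def
  proof
    fix A assume "A \<in> null_sets \<nu>"
    then have A: "A \<in> sets K" "emeasure N (T -` A \<inter> space N) = 0"
      by (auto simp: \<nu>_def null_sets_def emeasure_distr)
    then have "T -` A \<inter> space N \<in> null_sets N" by (auto simp: null_sets_def)
    then have "T -` A \<inter> space N \<in> null_sets (density N (\<lambda>x. ennreal (F x)))"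
      using absolutely_continuousI_density[of "\<lambda>x. ennreal (F x)" N] by (auto simp: absolutely_continuous_def)
    then show "A \<in> null_sets \<mu>" using A by (auto simp: \<mu>_def null_sets_def emeasure_distr)
  qed
  obtain D where D: "D \<in> borel_measurable \<nu>" "AE x in \<nu>. RN_deriv \<nu> \<mu> x = ennreal (D x)" "\<And>x. 0 \<le> D x"
    using \<nu>.real_RN_deriv[OF \<open>finite_measure \<mu>\<close> ac sets] by metis
  have D_K [measurable]: "D \<in> borel_measurable K" using D(1) by (simp add: \<nu>_def)
  have "\<mu> = density \<nu> (\<lambda>x. ennreal (D x))"
  proof -
    have "\<mu> = density \<nu> (RN_deriv \<nu> \<mu>)" by (rule \<nu>.density_RN_deriv[OF ac sets, symmetric])
    also have "\<dots> = density \<nu> (\<lambda>x. ennreal (D x))"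
      by (rule density_cong) (use D in auto)
    finally show ?thesis .
  qed
  show ?thesis
  proof (rule that[OF D_K D(3)])
    fix f :: "'b \<Rightarrow> ennreal" assume [measurable]: "f \<in> borel_measurable K"
    have "(\<integral>\<^sup>+x. ennreal (F x) * f (T x) \<partial>N) = integral\<^sup>N \<mu> f"
      by (simp add: \<mu>_def nn_integral_distr nn_integral_density)
    also have "\<dots> = (\<integral>\<^sup>+z. ennreal (D z) * f z \<partial>\<nu>)"
      unfolding \<open>\<mu> = density \<nu> (\<lambda>x. ennreal (D x))\<close> by (subst nn_integral_density) (simp_all add: \<nu>_def)
    also have "\<dots> = (\<integral>\<^sup>+x. ennreal (D (T x)) * f (T x) \<partial>N)"
      by (simp add: \<nu>_def nn_integral_distr)
    finally show "(\<integral>\<^sup>+x. ennreal (F x) * f (T x) \<partial>N) = (\<integral>\<^sup>+x. ennreal (D (T x)) * f (T x) \<partial>N)" .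
  qed
qed

lemma measure_eqI_nn_integral:
  assumes "sets M = sets N"
    and "\<And>f. f \<in> borel_measurable M \<Longrightarrow> integral\<^sup>N M f = integral\<^sup>N N f"
  shows "M = N"
proof (rule measure_eqI)
  fix A assume "A \<in> sets M"
  then show "emeasure M A = emeasure N A"
    using assms(2)[of "indicator A"] assms(1) by simp
qed fact

text \<open>The two real coordinates are independent and contribute \<open>v / 2\<close>
  each.\<close>

lemma nn_integral_cgauss_second_moment:
  assumes v: "v > 0"
  shows "(\<integral>\<^sup>+z. ennreal ((cmod z)\<^sup>2) \<partial>cgauss v) = ennreal v"
proof -
  define s where "s = sqrt (v / 2)"
  have s: "s > 0" "s\<^sup>2 = v / 2" using v by (auto simp: s_def)
  let ?d = "normal_density 0 s"
  have m0: "has_bochner_integral lborel ?d 1"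
    using s by (simp add: has_bochner_integral_iff)
  have m2: "has_bochner_integral lborel (\<lambda>x. ?d x * x\<^sup>2) (s\<^sup>2)"
    using normal_moment_even[of s 0 1] s(1) by simp
  have nn: "(\<integral>\<^sup>+x. ennreal (f x) \<partial>lborel) = ennreal i"
    if "has_bochner_integral lborel f i" "\<And>x. 0 \<le> f x" for f :: "real \<Rightarrow> real" and i
    using that by (simp add: has_bochner_integral_iff nn_integral_eq_integral)
  have "(\<integral>\<^sup>+z. ennreal ((cmod z)\<^sup>2) \<partial>cgauss v) =
      (\<integral>\<^sup>+a. \<integral>\<^sup>+b. ennreal (cgauss_density v (Complex a b)) * ennreal ((cmod (Complex a b))\<^sup>2) \<partial>lborel \<partial>lborel)"
    by (simp add: nn_integral_cgauss nn_integral_lborel_complex)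
  also have "\<dots> = (\<integral>\<^sup>+a. \<integral>\<^sup>+b. ennreal (?d a * a\<^sup>2 * ?d b + ?d a * (?d b * b\<^sup>2)) \<partial>lborel \<partial>lborel)"
    by (intro nn_integral_cong)
       (simp add: cgauss_density_eq_normal[OF v] s_def[symmetric] ennreal_mult[symmetric] cmod_power2
         Basis_complex_def inner_complex_def complex_eq_iff algebra_simps)
  also have "\<dots> = (\<integral>\<^sup>+a. ennreal (?d a * a\<^sup>2 * 1 + ?d a * s\<^sup>2) \<partial>lborel)"
    by (intro nn_integral_cong nn has_bochner_integral_add has_bochner_integral_mult_right m0 m2) auto
  also have "\<dots> = ennreal (s\<^sup>2 * 1 + 1 * s\<^sup>2)"
    by (intro nn has_bochner_integral_add has_bochner_integral_mult_left m0 m2) auto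
  finally show ?thesis using s by simp
qed

section \<open>Mixtures of likelihoods and the Gaussian output density\<close>

text \<open>Fubini reduces the claim to \<open>lik_reflection\<close>. The mixing measure is left
  general because it is instantiated both by \<open>cgauss P\<close> and by the input law.\<close>

lemma nn_integral_mixture_reflection:
  assumes "sigma_finite_measure \<mu>" and [measurable]: "X \<in> \<mu> \<rightarrow>\<^sub>M borel" and ab: "a\<^sup>2 + b\<^sup>2 = 1"
  shows "(\<integral>\<^sup>+w. \<integral>\<^sup>+q. ennreal (lik n (X q) (a *\<^sub>R y + b *\<^sub>R w)) \<partial>\<mu> \<partial>std_cgauss) =
    (\<integral>\<^sup>+q. ennreal (lik (n * a) (X q) y) \<partial>\<mu>)"
proof -
  interpret sigma_finite_measure \<mu> by fact
  interpret pair_sigma_finite \<mu> std_cgauss ..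
  have "(\<integral>\<^sup>+w. \<integral>\<^sup>+q. ennreal (lik n (X q) (a *\<^sub>R y + b *\<^sub>R w)) \<partial>\<mu> \<partial>std_cgauss) =
      (\<integral>\<^sup>+q. \<integral>\<^sup>+w. ennreal (lik n (X q) (a *\<^sub>R y + b *\<^sub>R w)) \<partial>std_cgauss \<partial>\<mu>)"
    by (rule Fubini') measurable
  also have "\<dots> = (\<integral>\<^sup>+q. ennreal (lik (n * a) (X q) y) \<partial>\<mu>)"
    by (simp add: lik_reflection[OF ab] ennreal_mult nn_integral_cmult)
  finally show ?thesis .
qed

text \<open>The density of the output \<open>n x + w\<close>, relative to the law of \<open>w\<close>, for a Gaussian input \<open>x\<close> of variance \<open>P\<close>.\<close>

definition gauss_out :: "real \<Rightarrow> real \<Rightarrow> complex \<Rightarrow> real" where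
  "gauss_out P n y = exp (P * n\<^sup>2 / (1 + P * n\<^sup>2) * (cmod y)\<^sup>2) / (1 + P * n\<^sup>2)"

lemma borel_measurable_gauss_out [measurable]: "gauss_out P n \<in> borel_measurable borel"
  unfolding gauss_out_def by measurable

lemma gauss_out_pos: "0 < P \<Longrightarrow> 0 < gauss_out P n y"
  unfolding gauss_out_def by (intro divide_pos_pos add_pos_nonneg) auto

text \<open>Completing the square: prior times likelihood is a Gaussian in \<open>x\<close>, the
  posterior, with mean \<open>?x0 = n v y\<close> and variance \<open>v\<close> given by
  \<open>1 / v = 1 / P + n^2\<close>. The factor left over, free of \<open>x\<close>, is the output
  density.\<close>

lemma nn_integral_lik_cgauss:
  assumes P: "P > 0"
  shows "(\<integral>\<^sup>+x. ennreal (lik n x y) \<partial>cgauss P) = ennreal (gauss_out P n y)"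
proof -
  define s where "s = 1 + P * n\<^sup>2"
  have s: "s > 0" unfolding s_def using P by (intro add_pos_nonneg) auto
  define v where "v = P / s"
  have v: "v > 0" using P s by (simp add: v_def)
  let ?x0 = "(n * v) *\<^sub>R y"
  have "cgauss_density P (?x0 + z) * lik n (?x0 + z) y = gauss_out P n y * cgauss_density v z" for z
  proof -
    have vs: "v * s = P" using s by (simp add: v_def)
    have iv: "1 / v = 1 / P + n\<^sup>2" using P s by (simp add: v_def s_def field_simps)
    have "- (cmod (?x0 + z))\<^sup>2 / P + (2 * n * ((?x0 + z) \<bullet> y) - n\<^sup>2 * (cmod (?x0 + z))\<^sup>2) =
        2 * n * ((?x0 + z) \<bullet> y) - (1 / v) * (cmod (?x0 + z))\<^sup>2"
      unfolding iv by (simp add: algebra_simps)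
    also have "\<dots> = n\<^sup>2 * v * (cmod y)\<^sup>2 - (cmod z)\<^sup>2 / v"
    proof -
      have "(cmod (?x0 + z))\<^sup>2 = (n * v)\<^sup>2 * (cmod y)\<^sup>2 + 2 * n * v * (z \<bullet> y) + (cmod z)\<^sup>2"
        unfolding power2_norm_eq_inner by (simp add: inner_simps inner_commute power2_eq_square algebra_simps)
      moreover have "(?x0 + z) \<bullet> y = n * v * (cmod y)\<^sup>2 + z \<bullet> y"
        unfolding power2_norm_eq_inner by (simp add: inner_simps)
      ultimately show ?thesis using v by (simp add: field_simps power2_eq_square)
    qed
    also have "n\<^sup>2 * v = P * n\<^sup>2 / s" by (simp add: v_def)
    finally have "exp (- (cmod (?x0 + z))\<^sup>2 / P) * lik n (?x0 + z) y =
        exp (P * n\<^sup>2 / s * (cmod y)\<^sup>2) * exp (- (cmod z)\<^sup>2 / v)"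
      by (simp add: lik_def exp_add[symmetric])
    then have "cgauss_density P (?x0 + z) * lik n (?x0 + z) y =
        exp (P * n\<^sup>2 / s * (cmod y)\<^sup>2) * exp (- (cmod z)\<^sup>2 / v) * (1 / (pi * P))"
      by (simp add: cgauss_density_def)
    also have "1 / (pi * P) = 1 / s * (1 / (pi * v))" using s by (simp add: v_def)
    finally show ?thesis by (simp add: gauss_out_def s_def[symmetric] cgauss_density_def)
  qed
  note eq = this
  have "(\<integral>\<^sup>+x. ennreal (lik n x y) \<partial>cgauss P) = (\<integral>\<^sup>+x. ennreal (cgauss_density P x * lik n x y) \<partial>lborel)"
    by (simp add: nn_integral_cgauss ennreal_mult cgauss_density_nonneg[OF P])
  also have "\<dots> = (\<integral>\<^sup>+z. ennreal (cgauss_density P (?x0 + z) * lik n (?x0 + z) y) \<partial>lborel)"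
    by (rule nn_integral_lborel_translate) measurable
  also have "\<dots> = (\<integral>\<^sup>+z. ennreal (cgauss_density v z) * ennreal (gauss_out P n y) \<partial>lborel)"
    by (simp add: eq ennreal_mult cgauss_density_nonneg[OF v] gauss_out_pos[OF P, THEN less_imp_le] mult.commute)
  also have "\<dots> = (\<integral>\<^sup>+z. ennreal (gauss_out P n y) \<partial>cgauss v)"
    by (subst nn_integral_cgauss) simp_all
  also have "\<dots> = ennreal (gauss_out P n y)"
    using prob_space.emeasure_space_1[OF prob_space_cgauss[OF v]] by simp
  finally show ?thesis .
qed

lemma nn_integral_gauss_out_reflection:
  assumes P: "P > 0" and ab: "a\<^sup>2 + b\<^sup>2 = 1"
  shows "(\<integral>\<^sup>+w. ennreal (gauss_out P n (a *\<^sub>R y + b *\<^sub>R w)) \<partial>std_cgauss) = ennreal (gauss_out P (n * a) y)"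
proof -
  interpret G: prob_space "cgauss P" by (rule prob_space_cgauss[OF P])
  show ?thesis
    using nn_integral_mixture_reflection[OF G.sigma_finite_measure_axioms, of "\<lambda>x. x" a b n y] ab
    by (simp add: nn_integral_lik_cgauss[OF P])
qed

section \<open>A power-limited input, its outputs and their joint laws\<close>

locale power_limited_input =
  fixes U :: "'u measure" and p :: "('u \<times> complex) measure" and P :: real
  assumes P_pos: "P > 0" and p_in: "p \<in> input_distributions U P"

sublocale power_limited_input \<subseteq> prob_space p
  using p_in by (simp add: input_distributions_def)

context power_limited_input
begin

lemma sets_p [measurable_cong]: "sets p = sets (U \<Otimes>\<^sub>M borel)"
  using p_in by (simp add: input_distributions_def)

sublocale pn: pair_prob_space p std_cgauss ..

sublocale nn: pair_prob_space std_cgauss std_cgauss ..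

sublocale pnn: pair_prob_space p "std_cgauss \<Otimes>\<^sub>M std_cgauss" ..

text \<open>The power actually spent, which may be below \<open>P\<close>. It is kept exact in all
  expectations; the budget enters the final bound through \<open>power_ratio_mono\<close>.\<close>

definition power :: real where
  "power = (\<integral>q. (cmod (snd q))\<^sup>2 \<partial>p)"

lemma integrable_power: "integrable p (\<lambda>q. (cmod (snd q))\<^sup>2)"
proof (rule integrableI_bounded)
  show "(\<lambda>q. (cmod (snd q))\<^sup>2) \<in> borel_measurable p" by measurable
  have "(\<integral>\<^sup>+q. ennreal (norm ((cmod (snd q))\<^sup>2)) \<partial>p) \<le> ennreal P"
    using p_in by (simp add: input_distributions_def)
  then show "(\<integral>\<^sup>+q. ennreal (norm ((cmod (snd q))\<^sup>2)) \<partial>p) < \<infinity>"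
    using ennreal_less_top le_less_trans by (metis infinity_ennreal_def)
qed

lemma power_le: "power \<le> P"
proof -
  have "ennreal power = (\<integral>\<^sup>+q. ennreal ((cmod (snd q))\<^sup>2) \<partial>p)"
    unfolding power_def by (rule nn_integral_eq_integral[symmetric, OF integrable_power]) simp
  also have "\<dots> \<le> ennreal P" using p_in by (simp add: input_distributions_def)
  finally show ?thesis using P_pos by simp
qed

text \<open>The density of \<open>n x + w\<close> relative to the noise law, the counterpart of
  \<open>gauss_out P n\<close> for the given input.\<close>

definition out :: "real \<Rightarrow> complex \<Rightarrow> real" where
  "out n y = (\<integral>q. lik n (snd q) y \<partial>p)"

lemma integrable_lik: "integrable p (\<lambda>q. lik n (snd q) y)"
  by (rule integrable_const_bound[where B = "exp ((cmod y)\<^sup>2)"]) (auto intro: lik_le)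

lemma ennreal_out: "ennreal (out n y) = (\<integral>\<^sup>+q. ennreal (lik n (snd q) y) \<partial>p)"
  unfolding out_def by (rule nn_integral_eq_integral[symmetric, OF integrable_lik]) simp

lemma borel_measurable_out [measurable]: "out n \<in> borel_measurable borel"
  unfolding out_def by measurable

text \<open>Positivity holds at every point, so quotients by \<open>out\<close> never meet the
  default value of division. For the conditional densities below it is obtained only almost
  everywhere.\<close>

lemma out_pos [simp]: "0 < out n y"
proof -
  have "(\<integral>\<^sup>+q. ennreal (lik n (snd q) y) \<partial>p) \<noteq> 0"
    by (subst nn_integral_0_iff_AE) (auto simp: not_le)
  then have "ennreal (out n y) \<noteq> 0" by (simp add: ennreal_out)
  then show ?thesis by (metis ennreal_eq_0_iff not_le)
qed

lemma out_nonneg [simp]: "0 \<le> out n y"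
  using out_pos[of n y] by linarith

lemma out_0 [simp]: "out 0 y = 1"
  by (simp add: out_def prob_space)

lemma nn_integral_out_reflection:
  assumes "a\<^sup>2 + b\<^sup>2 = 1"
  shows "(\<integral>\<^sup>+w. ennreal (out n (a *\<^sub>R y + b *\<^sub>R w)) \<partial>std_cgauss) = ennreal (out (n * a) y)"
  using nn_integral_mixture_reflection[OF sigma_finite_measure_axioms, of snd a b n y] assms
  by (simp add: ennreal_out)

lemma nn_integral_out: "(\<integral>\<^sup>+y. ennreal (out n y) \<partial>std_cgauss) = 1"
  \<comment> \<open>With \<open>a = 0\<close> and \<open>b = 1\<close> the left side no longer
    involves \<open>y\<close>, and on the right the gain is 0, where the density is 1.\<close>
  using nn_integral_out_reflection[of 0 1 n 0] by simp

text \<open>\<open>joint n\<close> is the law of \<open>((u, x), y)\<close> for \<open>y = n x + w\<close>, and \<open>joint2 n\<close> that of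
  \<open>((u, x), y, w')\<close> with \<open>w'\<close> an independent copy of \<open>w\<close>.\<close>

definition joint :: "real \<Rightarrow> (('u \<times> complex) \<times> complex) measure" where
  "joint n = density (p \<Otimes>\<^sub>M std_cgauss) (\<lambda>z. ennreal (lik n (snd (fst z)) (snd z)))"

definition joint2 :: "real \<Rightarrow> (('u \<times> complex) \<times> complex \<times> complex) measure" where
  "joint2 n = density (p \<Otimes>\<^sub>M (std_cgauss \<Otimes>\<^sub>M std_cgauss)) (\<lambda>z. ennreal (lik n (snd (fst z)) (fst (snd z))))"

lemma sets_joint [measurable_cong]: "sets (joint n) = sets (p \<Otimes>\<^sub>M borel)"
  unfolding joint_def by simp

lemma sets_joint2 [measurable_cong]: "sets (joint2 n) = sets (p \<Otimes>\<^sub>M (borel \<Otimes>\<^sub>M borel))"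
  unfolding joint2_def by simp

lemma nn_integral_joint:
  assumes [measurable]: "f \<in> borel_measurable (p \<Otimes>\<^sub>M borel)"
  shows "integral\<^sup>N (joint n) f = (\<integral>\<^sup>+q. \<integral>\<^sup>+y. ennreal (lik n (snd q) y) * f (q, y) \<partial>std_cgauss \<partial>p)"
  unfolding joint_def
  by (simp add: nn_integral_density std_cgauss.nn_integral_fst[symmetric])

lemma nn_integral_joint2:
  assumes [measurable]: "f \<in> borel_measurable (p \<Otimes>\<^sub>M (borel \<Otimes>\<^sub>M borel))"
  shows "integral\<^sup>N (joint2 n) f =
    (\<integral>\<^sup>+q. \<integral>\<^sup>+y. \<integral>\<^sup>+w. ennreal (lik n (snd q) y) * f (q, y, w) \<partial>std_cgauss \<partial>std_cgauss \<partial>p)"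
proof -
  have "integral\<^sup>N (joint2 n) f = (\<integral>\<^sup>+q. \<integral>\<^sup>+z. ennreal (lik n (snd q) (fst z)) * f (q, z) \<partial>(std_cgauss \<Otimes>\<^sub>M std_cgauss) \<partial>p)"
    unfolding joint2_def
    by (simp add: nn_integral_density nn.nn_integral_fst[symmetric])
  also have "\<dots> = (\<integral>\<^sup>+q. \<integral>\<^sup>+y. \<integral>\<^sup>+w. ennreal (lik n (snd q) y) * f (q, y, w) \<partial>std_cgauss \<partial>std_cgauss \<partial>p)"
    by (intro nn_integral_cong) (subst std_cgauss.nn_integral_fst[symmetric], auto)
  finally show ?thesis .
qed

lemma nn_integral_reflection:
  assumes [measurable]: "f \<in> borel_measurable (p \<Otimes>\<^sub>M (borel \<Otimes>\<^sub>M borel))" and ab: "a\<^sup>2 + b\<^sup>2 = 1"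
  shows "(\<integral>\<^sup>+q. \<integral>\<^sup>+y. \<integral>\<^sup>+w. f (q, y, w) \<partial>std_cgauss \<partial>std_cgauss \<partial>p) =
    (\<integral>\<^sup>+q. \<integral>\<^sup>+y. \<integral>\<^sup>+w. f (q, a *\<^sub>R y + b *\<^sub>R w, b *\<^sub>R y - a *\<^sub>R w) \<partial>std_cgauss \<partial>std_cgauss \<partial>p)"
proof (rule nn_integral_cong)
  fix q assume [measurable]: "q \<in> space p"
  have "(\<lambda>z. f (q, z)) \<in> borel_measurable (borel \<Otimes>\<^sub>M borel)" by measurable
  from nn_integral_std_cgauss_reflection[OF this ab]
  show "(\<integral>\<^sup>+y. \<integral>\<^sup>+w. f (q, y, w) \<partial>std_cgauss \<partial>std_cgauss) =
    (\<integral>\<^sup>+y. \<integral>\<^sup>+w. f (q, a *\<^sub>R y + b *\<^sub>R w, b *\<^sub>R y - a *\<^sub>R w) \<partial>std_cgauss \<partial>std_cgauss)" by simp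
qed

lemma reflection_involution:
  fixes y w :: complex
  assumes "a\<^sup>2 + b\<^sup>2 = 1"
  shows "a *\<^sub>R (a *\<^sub>R y + b *\<^sub>R w) + b *\<^sub>R (b *\<^sub>R y - a *\<^sub>R w) = y"
proof -
  have "a *\<^sub>R (a *\<^sub>R y + b *\<^sub>R w) + b *\<^sub>R (b *\<^sub>R y - a *\<^sub>R w) = (a\<^sup>2 + b\<^sup>2) *\<^sub>R y"
    by (simp add: power2_eq_square algebra_simps)
  then show ?thesis using assms by simp
qed

lemma prob_space_joint2: "prob_space (joint2 n)"
proof
  have "emeasure (joint2 n) (space (joint2 n)) = integral\<^sup>N (joint2 n) (\<lambda>_. 1)" by simp
  also have "\<dots> = 1"
    by (subst nn_integral_joint2) (use std_cgauss.emeasure_space_1 in \<open>simp_all add: emeasure_space_1\<close>)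
  finally show "emeasure (joint2 n) (space (joint2 n)) = 1" .
qed

text \<open>The density form of \<open>joint\<close> suits the reflection argument; this form is the
  channel itself and suits the computation of moments.\<close>

lemma joint_eq_distr:
  "joint n = distr (p \<Otimes>\<^sub>M std_cgauss) (p \<Otimes>\<^sub>M borel) (\<lambda>z. (fst z, n *\<^sub>R snd (fst z) + snd z))"
proof (rule measure_eqI_nn_integral)
  fix f :: "_ \<Rightarrow> ennreal" assume "f \<in> borel_measurable (joint n)"
  then have [measurable]: "f \<in> borel_measurable (p \<Otimes>\<^sub>M borel)"
    by (simp cong: measurable_cong_sets add: sets_joint)
  have "integral\<^sup>N (joint n) f = (\<integral>\<^sup>+q. \<integral>\<^sup>+w. f (q, n *\<^sub>R snd q + w) \<partial>std_cgauss \<partial>p)"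
    by (subst nn_integral_joint, measurable, rule nn_integral_cong)
       (rule nn_integral_std_cgauss_translate[symmetric], measurable)
  also have "\<dots> = integral\<^sup>N (distr (p \<Otimes>\<^sub>M std_cgauss) (p \<Otimes>\<^sub>M borel) (\<lambda>z. (fst z, n *\<^sub>R snd (fst z) + snd z))) f"
    by (simp add: nn_integral_distr std_cgauss.nn_integral_fst[symmetric])
  finally show "integral\<^sup>N (joint n) f =
    integral\<^sup>N (distr (p \<Otimes>\<^sub>M std_cgauss) (p \<Otimes>\<^sub>M borel) (\<lambda>z. (fst z, n *\<^sub>R snd (fst z) + snd z))) f" .
qed (simp add: sets_joint)

text \<open>The reflection is an involution: it brings the argument of the test function back to
  \<open>y\<close> and moves the likelihood to \<open>a y + b w\<close>, where it factors and
  \<open>w\<close> integrates out. Keeping the input as a coordinate gives degradation jointly with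
  \<open>(u, x)\<close>, which conditioning on \<open>u\<close> requires.\<close>

lemma distr_joint2_degraded:
  assumes ab: "a\<^sup>2 + b\<^sup>2 = 1"
  shows "distr (joint2 n) (p \<Otimes>\<^sub>M borel) (\<lambda>z. (fst z, a *\<^sub>R fst (snd z) + b *\<^sub>R snd (snd z))) = joint (n * a)"
proof (rule measure_eqI_nn_integral)
  fix f :: "_ \<Rightarrow> ennreal"
  assume "f \<in> borel_measurable (distr (joint2 n) (p \<Otimes>\<^sub>M borel) (\<lambda>z. (fst z, a *\<^sub>R fst (snd z) + b *\<^sub>R snd (snd z))))"
  then have [measurable]: "f \<in> borel_measurable (p \<Otimes>\<^sub>M borel)" by simp
  have "integral\<^sup>N (distr (joint2 n) (p \<Otimes>\<^sub>M borel) (\<lambda>z. (fst z, a *\<^sub>R fst (snd z) + b *\<^sub>R snd (snd z)))) f =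
      (\<integral>\<^sup>+q. \<integral>\<^sup>+y. \<integral>\<^sup>+w. ennreal (lik n (snd q) y) * f (q, a *\<^sub>R y + b *\<^sub>R w) \<partial>std_cgauss \<partial>std_cgauss \<partial>p)"
  proof -
    have "(\<lambda>z. (fst z, a *\<^sub>R fst (snd z) + b *\<^sub>R snd (snd z))) \<in> joint2 n \<rightarrow>\<^sub>M p \<Otimes>\<^sub>M borel"
      by measurable
    then have "integral\<^sup>N (distr (joint2 n) (p \<Otimes>\<^sub>M borel) (\<lambda>z. (fst z, a *\<^sub>R fst (snd z) + b *\<^sub>R snd (snd z)))) f =
        (\<integral>\<^sup>+z. f (fst z, a *\<^sub>R fst (snd z) + b *\<^sub>R snd (snd z)) \<partial>joint2 n)"
      by (rule nn_integral_distr) measurable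
    then show ?thesis by (simp add: nn_integral_joint2)
  qed
  also have "\<dots> = (\<integral>\<^sup>+q. \<integral>\<^sup>+y. \<integral>\<^sup>+w. ennreal (lik n (snd q) (a *\<^sub>R y + b *\<^sub>R w)) * f (q, y) \<partial>std_cgauss \<partial>std_cgauss \<partial>p)"
    using nn_integral_reflection[of "\<lambda>(q, y, w). ennreal (lik n (snd q) y) * f (q, a *\<^sub>R y + b *\<^sub>R w)", OF _ ab]
    by (simp add: reflection_involution[OF ab])
  also have "\<dots> = (\<integral>\<^sup>+q. \<integral>\<^sup>+y. ennreal (lik (n * a) (snd q) y) * f (q, y) \<partial>std_cgauss \<partial>p)"
    by (intro nn_integral_cong) (simp add: nn_integral_multc lik_reflection[OF ab] ennreal_mult nn_integral_cmult)
  also have "\<dots> = integral\<^sup>N (joint (n * a)) f"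
    by (subst nn_integral_joint) auto
  finally show "integral\<^sup>N (distr (joint2 n) (p \<Otimes>\<^sub>M borel) (\<lambda>z. (fst z, a *\<^sub>R fst (snd z) + b *\<^sub>R snd (snd z)))) f =
      integral\<^sup>N (joint (n * a)) f" .
qed (simp add: sets_joint)

lemma distr_joint2_fst:
  "distr (joint2 n) (p \<Otimes>\<^sub>M borel) (\<lambda>z. (fst z, fst (snd z))) = joint n"
  using distr_joint2_degraded[of 1 0 n] by simp

lemma moments_product:
  shows "has_bochner_integral (p \<Otimes>\<^sub>M std_cgauss) (\<lambda>z. (cmod (snd (fst z)))\<^sup>2) power"
    and "has_bochner_integral (p \<Otimes>\<^sub>M std_cgauss) (\<lambda>z. (cmod (snd z))\<^sup>2) 1"
    and "has_bochner_integral (p \<Otimes>\<^sub>M std_cgauss) (\<lambda>z. snd (fst z) \<bullet> snd z) 0"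
proof -
  show x2: "has_bochner_integral (p \<Otimes>\<^sub>M std_cgauss) (\<lambda>z. (cmod (snd (fst z)))\<^sup>2) power"
  proof -
    have "has_bochner_integral (distr (p \<Otimes>\<^sub>M std_cgauss) p fst) (\<lambda>q. (cmod (snd q))\<^sup>2) power"
      unfolding std_cgauss.distr_pair_fst by (simp add: has_bochner_integral_iff integrable_power power_def)
    then show ?thesis by (simp add: has_bochner_integral_iff integrable_distr_eq integral_distr)
  qed
  show w2: "has_bochner_integral (p \<Otimes>\<^sub>M std_cgauss) (\<lambda>z. (cmod (snd z))\<^sup>2) 1"
  proof (rule has_bochner_integral_nn_integral)
    have "(\<integral>\<^sup>+z. ennreal ((cmod (snd z))\<^sup>2) \<partial>(p \<Otimes>\<^sub>M std_cgauss)) =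
        (\<integral>\<^sup>+q. \<integral>\<^sup>+w. ennreal ((cmod w)\<^sup>2) \<partial>std_cgauss \<partial>p)"
      by (subst std_cgauss.nn_integral_fst[symmetric]) simp_all
    then show "(\<integral>\<^sup>+z. ennreal ((cmod (snd z))\<^sup>2) \<partial>(p \<Otimes>\<^sub>M std_cgauss)) = ennreal 1"
      by (simp add: nn_integral_cgauss_second_moment emeasure_space_1)
  qed simp_all
  have int: "integrable (p \<Otimes>\<^sub>M std_cgauss) (\<lambda>z. snd (fst z) \<bullet> snd z)"
  proof (rule Bochner_Integration.integrable_bound)
    show "integrable (p \<Otimes>\<^sub>M std_cgauss) (\<lambda>z. (cmod (snd (fst z)))\<^sup>2 + (cmod (snd z))\<^sup>2)"
      using x2 w2 by (auto simp: has_bochner_integral_iff)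
    have "\<bar>x \<bullet> y\<bar> \<le> (cmod x)\<^sup>2 + (cmod y)\<^sup>2" for x y :: complex
    proof -
      have "\<bar>x \<bullet> y\<bar> \<le> cmod x * cmod y" by (rule Cauchy_Schwarz_ineq2)
      also have "\<dots> \<le> (cmod x)\<^sup>2 + (cmod y)\<^sup>2"
      proof -
        have "0 \<le> cmod x * cmod y" by simp
        then show ?thesis using sum_squares_bound[of "cmod x" "cmod y"] by linarith
      qed
      finally show ?thesis .
    qed
    then show "AE z in p \<Otimes>\<^sub>M std_cgauss. norm (snd (fst z) \<bullet> snd z) \<le> norm ((cmod (snd (fst z)))\<^sup>2 + (cmod (snd z))\<^sup>2)"
      by simp
  qed measurable
  \<comment> \<open>The cross moment vanishes because the noise law is invariant under
    \<open>w \<mapsto> - w\<close>.\<close>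
  have "distr (p \<Otimes>\<^sub>M std_cgauss) (p \<Otimes>\<^sub>M std_cgauss) (\<lambda>z. (fst z, - snd z)) = p \<Otimes>\<^sub>M std_cgauss"
  proof (rule measure_eqI_nn_integral)
    fix f :: "_ \<Rightarrow> ennreal"
    assume "f \<in> borel_measurable (distr (p \<Otimes>\<^sub>M std_cgauss) (p \<Otimes>\<^sub>M std_cgauss) (\<lambda>z. (fst z, - snd z)))"
    then have [measurable]: "f \<in> borel_measurable (p \<Otimes>\<^sub>M borel)" by simp
    have "integral\<^sup>N (distr (p \<Otimes>\<^sub>M std_cgauss) (p \<Otimes>\<^sub>M std_cgauss) (\<lambda>z. (fst z, - snd z))) f =
        (\<integral>\<^sup>+q. \<integral>\<^sup>+w. f (q, - w) \<partial>std_cgauss \<partial>p)"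
      by (simp add: nn_integral_distr std_cgauss.nn_integral_fst[symmetric])
    also have "\<dots> = (\<integral>\<^sup>+q. \<integral>\<^sup>+w. f (q, w) \<partial>std_cgauss \<partial>p)"
    proof (rule nn_integral_cong)
      fix q assume [measurable]: "q \<in> space p"
      show "(\<integral>\<^sup>+w. f (q, - w) \<partial>std_cgauss) = (\<integral>\<^sup>+w. f (q, w) \<partial>std_cgauss)"
        using nn_integral_cgauss_unit_mult[of "\<lambda>w. f (q, w)" "-1" 1] by simp
    qed
    also have "\<dots> = integral\<^sup>N (p \<Otimes>\<^sub>M std_cgauss) f"
      by (rule std_cgauss.nn_integral_fst) measurable
    finally show "integral\<^sup>N (distr (p \<Otimes>\<^sub>M std_cgauss) (p \<Otimes>\<^sub>M std_cgauss) (\<lambda>z. (fst z, - snd z))) f =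
      integral\<^sup>N (p \<Otimes>\<^sub>M std_cgauss) f" .
  qed simp
  then have "(\<integral>z. snd (fst z) \<bullet> snd z \<partial>(p \<Otimes>\<^sub>M std_cgauss)) =
      (\<integral>z. snd (fst z) \<bullet> snd z \<partial>distr (p \<Otimes>\<^sub>M std_cgauss) (p \<Otimes>\<^sub>M std_cgauss) (\<lambda>z. (fst z, - snd z)))"
    by simp
  also have "\<dots> = - (\<integral>z. snd (fst z) \<bullet> snd z \<partial>(p \<Otimes>\<^sub>M std_cgauss))"
    by (subst integral_distr) simp_all
  finally show "has_bochner_integral (p \<Otimes>\<^sub>M std_cgauss) (\<lambda>z. snd (fst z) \<bullet> snd z) 0"
    using int by (simp add: has_bochner_integral_iff)
qed

text \<open>After the substitution \<open>y = n x + w\<close> the integrand is a quadratic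
  polynomial in \<open>x\<close> and \<open>w\<close>, so finite power is all the integrability
  needed. The expectation is the information \<open>I(x; y)\<close> plus the divergence of the
  output from the Gaussian one; for \<open>power = P\<close> only the logarithm survives.\<close>

lemma has_bochner_integral_joint_log_ratio:
  "has_bochner_integral (joint n) (\<lambda>z. ln (lik n (snd (fst z)) (snd z)) - ln (gauss_out P n (snd z)))
    (n\<^sup>2 * (power - P) / (1 + P * n\<^sup>2) + ln (1 + P * n\<^sup>2))"
proof -
  define s where "s = 1 + P * n\<^sup>2"
  have s: "s > 0" unfolding s_def using P_pos by (intro add_pos_nonneg) auto
  \<comment> \<open>The constants collapse because \<open>1 - ?k = 1 / s\<close>.\<close>
  let ?k = "P * n\<^sup>2 / s"
  have eq: "ln (lik n x (n *\<^sub>R x + w)) - ln (gauss_out P n (n *\<^sub>R x + w)) =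
      (n\<^sup>2 - ?k * n\<^sup>2) * (cmod x)\<^sup>2 + (2 * n - 2 * ?k * n) * (x \<bullet> w) - ?k * (cmod w)\<^sup>2 + ln s" for x w
  proof -
    have A: "(cmod (n *\<^sub>R x + w))\<^sup>2 = n\<^sup>2 * (cmod x)\<^sup>2 + 2 * n * (x \<bullet> w) + (cmod w)\<^sup>2"
      unfolding power2_norm_eq_inner by (simp add: inner_simps inner_commute power2_eq_square algebra_simps)
    have B: "x \<bullet> (n *\<^sub>R x + w) = n * (cmod x)\<^sup>2 + x \<bullet> w"
      unfolding power2_norm_eq_inner by (simp add: inner_simps)
    have C: "ln (gauss_out P n y) = ?k * (cmod y)\<^sup>2 - ln s" for y
      using s by (simp add: gauss_out_def s_def[symmetric] ln_div)
    have E: "ln (lik n x y) = 2 * n * (x \<bullet> y) - n\<^sup>2 * (cmod x)\<^sup>2" for y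
      by (simp add: lik_def)
    show ?thesis unfolding C E A B by (simp add: power2_eq_square algebra_simps)
  qed
  interpret pn: prob_space "p \<Otimes>\<^sub>M std_cgauss" by (rule pn.P.prob_space_axioms)
  have "has_bochner_integral (p \<Otimes>\<^sub>M std_cgauss)
     (\<lambda>z. (n\<^sup>2 - ?k * n\<^sup>2) * (cmod (snd (fst z)))\<^sup>2 + (2 * n - 2 * ?k * n) * (snd (fst z) \<bullet> snd z)
        - ?k * (cmod (snd z))\<^sup>2 + ln s)
     ((n\<^sup>2 - ?k * n\<^sup>2) * power + (2 * n - 2 * ?k * n) * 0 - ?k * 1 + ln s)"
    by (intro has_bochner_integral_add has_bochner_integral_diff has_bochner_integral_mult_right moments_product)
       (simp add: has_bochner_integral_iff pn.prob_space)
  moreover have "(n\<^sup>2 - ?k * n\<^sup>2) * power + (2 * n - 2 * ?k * n) * 0 - ?k * 1 + ln s =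
      n\<^sup>2 * (power - P) / s + ln s"
    using s by (simp add: field_simps) (simp add: s_def algebra_simps)
  ultimately show ?thesis
    unfolding joint_eq_distr has_bochner_integral_iff s_def[symmetric]
    by (simp add: integrable_distr_eq integral_distr eq)
qed

end

lemma integrable_le_1:
  fixes f :: "'a \<Rightarrow> real"
  assumes [measurable]: "f \<in> borel_measurable M" and "\<And>x. 0 \<le> f x" and "(\<integral>\<^sup>+x. ennreal (f x) \<partial>M) \<le> 1"
  shows "integrable M f" "integral\<^sup>L M f \<le> 1"
proof -
  have "(\<integral>\<^sup>+x. ennreal (norm (f x)) \<partial>M) < \<infinity>"
    using assms(2,3) by (simp add: le_less_trans[OF _ ennreal_one_less_top])
  then show int: "integrable M f" by (intro integrableI_bounded) auto
  have "ennreal (integral\<^sup>L M f) \<le> ennreal 1"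
    using nn_integral_eq_integral[OF int] assms(2,3) by simp
  then show "integral\<^sup>L M f \<le> 1" by (subst (asm) ennreal_le_iff) auto
qed

context power_limited_input
begin

section \<open>Conditional densities\<close>

text \<open>\<open>D\<close> is the density of \<open>(u, n x + w)\<close> relative to the product of the laws of \<open>u\<close> and \<open>w\<close>:
  \<open>D (u, y)\<close> plays the role of the conditional expectation of \<open>lik n x y\<close> given \<open>u\<close>.\<close>

definition cond_density :: "real \<Rightarrow> ('u \<times> complex \<Rightarrow> real) \<Rightarrow> bool" where
  "cond_density n D \<longleftrightarrow> D \<in> borel_measurable (U \<Otimes>\<^sub>M borel) \<and> (\<forall>z. 0 \<le> D z) \<and>
    (\<forall>f\<in>borel_measurable (U \<Otimes>\<^sub>M borel).
      (\<integral>\<^sup>+q. \<integral>\<^sup>+y. ennreal (lik n (snd q) y) * f (fst q, y) \<partial>std_cgauss \<partial>p) =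
      (\<integral>\<^sup>+q. \<integral>\<^sup>+y. ennreal (D (fst q, y)) * f (fst q, y) \<partial>std_cgauss \<partial>p))"

lemma fst_in_space_U: "q \<in> space p \<Longrightarrow> fst q \<in> space U"
  by (auto simp: sets_eq_imp_space_eq[OF sets_p] space_pair_measure)

lemma cond_density_measurable:
  "cond_density n D \<Longrightarrow> D \<in> borel_measurable (U \<Otimes>\<^sub>M borel)"
  by (simp add: cond_density_def)

lemma cond_density_nonneg: "cond_density n D \<Longrightarrow> 0 \<le> D z"
  unfolding cond_density_def by blast

lemma cond_densityD:
  "cond_density n D \<Longrightarrow> f \<in> borel_measurable (U \<Otimes>\<^sub>M borel) \<Longrightarrow>
    (\<integral>\<^sup>+q. \<integral>\<^sup>+y. ennreal (lik n (snd q) y) * f (fst q, y) \<partial>std_cgauss \<partial>p) =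
    (\<integral>\<^sup>+q. \<integral>\<^sup>+y. ennreal (D (fst q, y)) * f (fst q, y) \<partial>std_cgauss \<partial>p)"
  by (simp add: cond_density_def)

lemma cond_densityD2:
  assumes D: "cond_density n D" and [measurable]: "f \<in> borel_measurable (U \<Otimes>\<^sub>M (borel \<Otimes>\<^sub>M borel))"
  shows "(\<integral>\<^sup>+q. \<integral>\<^sup>+y. \<integral>\<^sup>+w. ennreal (lik n (snd q) y) * f (fst q, y, w) \<partial>std_cgauss \<partial>std_cgauss \<partial>p) =
    (\<integral>\<^sup>+q. \<integral>\<^sup>+y. \<integral>\<^sup>+w. ennreal (D (fst q, y)) * f (fst q, y, w) \<partial>std_cgauss \<partial>std_cgauss \<partial>p)"
proof -
  have pull: "(\<integral>\<^sup>+q. \<integral>\<^sup>+y. \<integral>\<^sup>+w. c q y * f (fst q, y, w) \<partial>std_cgauss \<partial>std_cgauss \<partial>p) =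
      (\<integral>\<^sup>+q. \<integral>\<^sup>+y. c q y * (\<integral>\<^sup>+w. f (fst q, y, w) \<partial>std_cgauss) \<partial>std_cgauss \<partial>p)" for c :: "_ \<Rightarrow> _ \<Rightarrow> ennreal"
  proof (rule nn_integral_cong)
    fix q assume [measurable]: "q \<in> space p"
    have "fst q \<in> space U"
      using \<open>q \<in> space p\<close> by (rule fst_in_space_U)
    then show "(\<integral>\<^sup>+y. \<integral>\<^sup>+w. c q y * f (fst q, y, w) \<partial>std_cgauss \<partial>std_cgauss) =
      (\<integral>\<^sup>+y. c q y * (\<integral>\<^sup>+w. f (fst q, y, w) \<partial>std_cgauss) \<partial>std_cgauss)"
      by (intro nn_integral_cong nn_integral_cmult) simp
  qed
  have "(\<lambda>(u, y). \<integral>\<^sup>+w. f (u, y, w) \<partial>std_cgauss) \<in> borel_measurable (U \<Otimes>\<^sub>M borel)"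
    by measurable
  from cond_densityD[OF D this] show ?thesis unfolding pull by simp
qed

lemma exists_cond_density: obtains D where "cond_density n D"
proof -
  have [measurable]: "(\<lambda>z. (fst (fst z), snd z)) \<in> p \<Otimes>\<^sub>M std_cgauss \<rightarrow>\<^sub>M U \<Otimes>\<^sub>M borel"
    by measurable
  have "(\<integral>\<^sup>+z. ennreal (lik n (snd (fst z)) (snd z)) \<partial>(p \<Otimes>\<^sub>M std_cgauss)) = 1"
    by (subst std_cgauss.nn_integral_fst[symmetric]) (simp_all add: emeasure_space_1)
  from exists_conditional_density[OF pn.P.prob_space_axioms, of "\<lambda>z. (fst (fst z), snd z)" "U \<Otimes>\<^sub>M borel", OF _ _ this]
  obtain D where [measurable]: "D \<in> borel_measurable (U \<Otimes>\<^sub>M borel)" and D: "\<And>z. 0 \<le> D z"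
    "\<And>f. f \<in> borel_measurable (U \<Otimes>\<^sub>M borel) \<Longrightarrow>
      (\<integral>\<^sup>+z. ennreal (lik n (snd (fst z)) (snd z)) * f (fst (fst z), snd z) \<partial>(p \<Otimes>\<^sub>M std_cgauss)) =
      (\<integral>\<^sup>+z. ennreal (D (fst (fst z), snd z)) * f (fst (fst z), snd z) \<partial>(p \<Otimes>\<^sub>M std_cgauss))"
    by auto
  have "cond_density n D"
    unfolding cond_density_def
  proof (intro conjI allI ballI D(1))
    fix f :: "'u \<times> complex \<Rightarrow> ennreal" assume [measurable]: "f \<in> borel_measurable (U \<Otimes>\<^sub>M borel)"
    show "(\<integral>\<^sup>+q. \<integral>\<^sup>+y. ennreal (lik n (snd q) y) * f (fst q, y) \<partial>std_cgauss \<partial>p) =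
      (\<integral>\<^sup>+q. \<integral>\<^sup>+y. ennreal (D (fst q, y)) * f (fst q, y) \<partial>std_cgauss \<partial>p)"
      using D(2)[of f] by (simp add: std_cgauss.nn_integral_fst[symmetric])
  qed measurable
  then show ?thesis by (rule that)
qed

text \<open>At gain 0 the output is pure noise and tells nothing about \<open>u\<close>. This is the
  reference channel from which integrability at every other gain is derived.\<close>

lemma cond_density_0: "cond_density 0 (\<lambda>_. 1)"
  by (simp add: cond_density_def)

lemma nn_integral_cond_density:
  assumes "cond_density n D"
  shows "(\<integral>\<^sup>+q. \<integral>\<^sup>+y. ennreal (D (fst q, y)) \<partial>std_cgauss \<partial>p) = 1"
  using cond_densityD[OF assms, of "\<lambda>_. 1"] by (simp add: emeasure_space_1)

text \<open>The defining identity is tested on the indicator of the zero set of \<open>D\<close>: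
  the joint law gives this set the integral of \<open>D\<close> over it, which is 0.\<close>

lemma AE_cond_density_pos:
  assumes D: "cond_density n D"
  shows "AE z in joint n. 0 < D (fst (fst z), snd z)"
proof -
  note [measurable] = cond_density_measurable[OF D]
  let ?f = "\<lambda>z. indicator {0} (D z) :: ennreal"
  have "(\<integral>\<^sup>+z. ?f (fst (fst z), snd z) \<partial>joint n) =
      (\<integral>\<^sup>+q. \<integral>\<^sup>+y. ennreal (lik n (snd q) y) * ?f (fst q, y) \<partial>std_cgauss \<partial>p)"
    by (subst nn_integral_joint) simp_all
  also have "\<dots> = (\<integral>\<^sup>+q. \<integral>\<^sup>+y. ennreal (D (fst q, y)) * ?f (fst q, y) \<partial>std_cgauss \<partial>p)"
    by (rule cond_densityD[OF D]) measurable
  also have "\<dots> = (\<integral>\<^sup>+q. \<integral>\<^sup>+y. 0 \<partial>std_cgauss \<partial>p)"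
    by (intro nn_integral_cong) (auto simp: indicator_def)
  finally have "(\<integral>\<^sup>+z. ?f (fst (fst z), snd z) \<partial>joint n) = 0" by simp
  then have "AE z in joint n. ?f (fst (fst z), snd z) = 0"
    by (subst (asm) nn_integral_0_iff_AE) measurable
  then show ?thesis
    by (rule eventually_mono) (use cond_density_nonneg[OF D] in \<open>auto simp: indicator_def less_le split: if_splits\<close>)
qed

lemma nn_integral_joint2_out:
  assumes [measurable]: "f \<in> borel_measurable (borel \<Otimes>\<^sub>M borel)"
  shows "(\<integral>\<^sup>+z. f (snd z) \<partial>joint2 n) = (\<integral>\<^sup>+y. \<integral>\<^sup>+w. ennreal (out n y) * f (y, w) \<partial>std_cgauss \<partial>std_cgauss)"
proof -
  have "(\<integral>\<^sup>+z. f (snd z) \<partial>joint2 n) =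
      (\<integral>\<^sup>+q. \<integral>\<^sup>+y. ennreal (lik n (snd q) y) * (\<integral>\<^sup>+w. f (y, w) \<partial>std_cgauss) \<partial>std_cgauss \<partial>p)"
    by (subst nn_integral_joint2) (simp_all add: nn_integral_cmult)
  also have "\<dots> = (\<integral>\<^sup>+y. \<integral>\<^sup>+q. ennreal (lik n (snd q) y) * (\<integral>\<^sup>+w. f (y, w) \<partial>std_cgauss) \<partial>p \<partial>std_cgauss)"
    by (rule pn.Fubini'[symmetric]) measurable
  also have "\<dots> = (\<integral>\<^sup>+y. \<integral>\<^sup>+w. ennreal (out n y) * f (y, w) \<partial>std_cgauss \<partial>std_cgauss)"
    by (intro nn_integral_cong) (simp add: nn_integral_multc nn_integral_cmult ennreal_out)
  finally show ?thesis .
qed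

section \<open>Degrading the channel\<close>

context
  fixes n a b m :: real and D D' :: "'u \<times> complex \<Rightarrow> real"
  assumes ab: "a\<^sup>2 + b\<^sup>2 = 1" and m: "m = n * a" and D: "cond_density n D" and D': "cond_density m D'"
begin

abbreviation (input) degraded :: "complex \<times> complex \<Rightarrow> complex" where
  "degraded z \<equiv> a *\<^sub>R fst z + b *\<^sub>R snd z"

lemma D_measurable [measurable]: "D \<in> borel_measurable (U \<Otimes>\<^sub>M borel)"
  by (rule cond_density_measurable[OF D])

lemma D'_measurable [measurable]: "D' \<in> borel_measurable (U \<Otimes>\<^sub>M borel)"
  by (rule cond_density_measurable[OF D'])

text \<open>The ratio is the density of \<open>y\<close> given \<open>(u, y')\<close> over that
  given \<open>(x, y')\<close>, so its logarithm encodes \<open>I(x; y | u, y') \<ge> 0\<close> and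
  thereby the passage from \<open>u\<close> to \<open>x\<close>. The weight of
  \<open>joint2 n\<close> cancels \<open>lik n\<close>; after a reflection, \<open>lik m\<close> is
  the only factor involving \<open>x\<close> and can be replaced by \<open>D'\<close>, which cancels
  in turn. As \<open>D\<close> is fixed only up to null sets, no pointwise analogue of
  \<open>nn_integral_out_reflection\<close> is invoked: a second reflection recovers the total mass
  instead.\<close>

lemma likelihood_ratio_le_1:
  "(\<integral>\<^sup>+z. ennreal (D (fst (fst z), fst (snd z)) * lik m (snd (fst z)) (degraded (snd z)) /
      (D' (fst (fst z), degraded (snd z)) * lik n (snd (fst z)) (fst (snd z)))) \<partial>joint2 n) \<le> 1"
proof -
  let ?c = "\<lambda>u y. ennreal (inverse (D' (u, y)))"
  note nn = cond_density_nonneg[OF D] cond_density_nonneg[OF D']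
  have "(\<integral>\<^sup>+z. ennreal (D (fst (fst z), fst (snd z)) * lik m (snd (fst z)) (degraded (snd z)) /
      (D' (fst (fst z), degraded (snd z)) * lik n (snd (fst z)) (fst (snd z)))) \<partial>joint2 n) =
    (\<integral>\<^sup>+q. \<integral>\<^sup>+y. \<integral>\<^sup>+w. ennreal (D (fst q, y)) * (ennreal (lik m (snd q) (a *\<^sub>R y + b *\<^sub>R w)) *
      ?c (fst q) (a *\<^sub>R y + b *\<^sub>R w)) \<partial>std_cgauss \<partial>std_cgauss \<partial>p)"
    by (subst nn_integral_joint2, measurable, intro nn_integral_cong)
       (simp add: ennreal_mult[symmetric] nn divide_inverse)
  also have "\<dots> = (\<integral>\<^sup>+q. \<integral>\<^sup>+y. \<integral>\<^sup>+w. ennreal (D (fst q, a *\<^sub>R y + b *\<^sub>R w)) *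
      (ennreal (lik m (snd q) y) * ?c (fst q) y) \<partial>std_cgauss \<partial>std_cgauss \<partial>p)"
    using nn_integral_reflection[of "\<lambda>(q, y, w). ennreal (D (fst q, y)) * (ennreal (lik m (snd q) (a *\<^sub>R y + b *\<^sub>R w)) *
      ?c (fst q) (a *\<^sub>R y + b *\<^sub>R w))", OF _ ab]
    by (simp add: reflection_involution[OF ab])
  also have "\<dots> = (\<integral>\<^sup>+q. \<integral>\<^sup>+y. ennreal (lik m (snd q) y) *
      (\<lambda>(u, y). (\<integral>\<^sup>+w. ennreal (D (u, a *\<^sub>R y + b *\<^sub>R w)) \<partial>std_cgauss) * ?c u y) (fst q, y) \<partial>std_cgauss \<partial>p)"
  proof (intro nn_integral_cong)
    fix q y assume q: "q \<in> space p"
    have [measurable]: "fst q \<in> space U"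
      using q by (rule fst_in_space_U)
    show "(\<integral>\<^sup>+w. ennreal (D (fst q, a *\<^sub>R y + b *\<^sub>R w)) * (ennreal (lik m (snd q) y) * ?c (fst q) y) \<partial>std_cgauss) =
      ennreal (lik m (snd q) y) *
      (\<lambda>(u, y). (\<integral>\<^sup>+w. ennreal (D (u, a *\<^sub>R y + b *\<^sub>R w)) \<partial>std_cgauss) * ?c u y) (fst q, y)"
      by (subst nn_integral_multc) (simp_all add: ac_simps)
  qed
  also have "\<dots> = (\<integral>\<^sup>+q. \<integral>\<^sup>+y. ennreal (D' (fst q, y)) *
      (\<lambda>(u, y). (\<integral>\<^sup>+w. ennreal (D (u, a *\<^sub>R y + b *\<^sub>R w)) \<partial>std_cgauss) * ?c u y) (fst q, y) \<partial>std_cgauss \<partial>p)"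
    by (rule cond_densityD[OF D']) measurable
  also have "\<dots> \<le> (\<integral>\<^sup>+q. \<integral>\<^sup>+y. \<integral>\<^sup>+w. ennreal (D (fst q, a *\<^sub>R y + b *\<^sub>R w)) \<partial>std_cgauss \<partial>std_cgauss \<partial>p)"
  proof (intro nn_integral_mono)
    \<comment> \<open>Where \<open>D'\<close> vanishes, \<open>inverse\<close> is 0 and the product
      is 0 instead of 1, hence an inequality.\<close>
    fix q y
    have "ennreal (D' (fst q, y)) * ?c (fst q) y \<le> 1"
      by (cases "D' (fst q, y) = 0") (simp_all add: ennreal_mult[symmetric] nn)
    then show "ennreal (D' (fst q, y)) *
        (\<lambda>(u, y). (\<integral>\<^sup>+w. ennreal (D (u, a *\<^sub>R y + b *\<^sub>R w)) \<partial>std_cgauss) * ?c u y) (fst q, y)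
      \<le> (\<integral>\<^sup>+w. ennreal (D (fst q, a *\<^sub>R y + b *\<^sub>R w)) \<partial>std_cgauss)"
      using mult_left_mono[of "ennreal (D' (fst q, y)) * ?c (fst q) y" 1 "\<integral>\<^sup>+w. ennreal (D (fst q, a *\<^sub>R y + b *\<^sub>R w)) \<partial>std_cgauss"]
      by (simp add: ac_simps)
  qed
  also have "\<dots> = (\<integral>\<^sup>+q. \<integral>\<^sup>+y. \<integral>\<^sup>+w. ennreal (D (fst q, y)) \<partial>std_cgauss \<partial>std_cgauss \<partial>p)"
    using nn_integral_reflection[of "\<lambda>(q, y, w). ennreal (D (fst q, y))", OF _ ab] by simp
  also have "\<dots> = 1"
    using std_cgauss.emeasure_space_1 by (simp add: nn_integral_cond_density[OF D])
  finally show ?thesis .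
qed

text \<open>This compares the conditional density of \<open>y\<close> given \<open>y'\<close> for a
  Gaussian input with the one for the given input; its logarithm encodes a nonnegative divergence,
  which is why the Gaussian is extremal. Reflection and averaging turn \<open>gauss_out P n\<close>
  into \<open>gauss_out P m\<close>, which cancels and leaves the mass of
  \<open>out m\<close>.\<close>

lemma output_ratio_le_1:
  "(\<integral>\<^sup>+z. ennreal (gauss_out P n (fst (snd z)) * out m (degraded (snd z)) /
      (gauss_out P m (degraded (snd z)) * out n (fst (snd z)))) \<partial>joint2 n) \<le> 1"
proof -
  note G = gauss_out_pos[OF P_pos]
  let ?c = "\<lambda>y. ennreal (out m y / gauss_out P m y)"
  have "(\<integral>\<^sup>+z. ennreal (gauss_out P n (fst (snd z)) * out m (degraded (snd z)) /
      (gauss_out P m (degraded (snd z)) * out n (fst (snd z)))) \<partial>joint2 n) =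
    (\<integral>\<^sup>+y. \<integral>\<^sup>+w. ennreal (gauss_out P n y) * ?c (a *\<^sub>R y + b *\<^sub>R w) \<partial>std_cgauss \<partial>std_cgauss)"
    by (subst nn_integral_joint2_out, measurable, intro nn_integral_cong)
       (simp add: ennreal_mult[symmetric] G less_imp_le out_pos[THEN less_imp_neq, symmetric])
  also have "\<dots> = (\<integral>\<^sup>+y. \<integral>\<^sup>+w. ennreal (gauss_out P n (a *\<^sub>R y + b *\<^sub>R w)) * ?c y \<partial>std_cgauss \<partial>std_cgauss)"
    using nn_integral_std_cgauss_reflection[of "\<lambda>(y, w). ennreal (gauss_out P n y) * ?c (a *\<^sub>R y + b *\<^sub>R w)", OF _ ab]
    by (simp add: reflection_involution[OF ab])
  also have "\<dots> = (\<integral>\<^sup>+y. ennreal (gauss_out P m y) * ?c y \<partial>std_cgauss)"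
    by (intro nn_integral_cong) (simp add: nn_integral_multc nn_integral_gauss_out_reflection[OF P_pos ab] m)
  also have "\<dots> = (\<integral>\<^sup>+y. ennreal (out m y) \<partial>std_cgauss)"
    by (intro nn_integral_cong) (simp add: ennreal_mult[symmetric] G less_imp_le G[THEN less_imp_neq, symmetric])
  finally show ?thesis by (simp add: nn_integral_out)
qed

text \<open>The ratio is the density of \<open>y\<close> given \<open>y'\<close> over that given
  \<open>(u, y')\<close>, so its logarithm encodes \<open>I(u; y | y') \<ge> 0\<close>. Here the
  likelihood is replaced by \<open>D\<close> first, because everything else depends on
  \<open>(u, y, w')\<close> only; the reflection of \<open>out\<close> then holds pointwise.\<close>

lemma inverse_ratio_le_1:
  "(\<integral>\<^sup>+z. ennreal (out n (fst (snd z)) * D' (fst (fst z), degraded (snd z)) /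
      (D (fst (fst z), fst (snd z)) * out m (degraded (snd z)))) \<partial>joint2 n) \<le> 1"
proof -
  note nn = cond_density_nonneg[OF D] cond_density_nonneg[OF D']
  let ?c = "\<lambda>u y. ennreal (D' (u, y) / out m y)"
  let ?f = "\<lambda>(u, y, w). ennreal (out n y * inverse (D (u, y))) * ?c u (a *\<^sub>R y + b *\<^sub>R w)"
  have "(\<integral>\<^sup>+z. ennreal (out n (fst (snd z)) * D' (fst (fst z), degraded (snd z)) /
      (D (fst (fst z), fst (snd z)) * out m (degraded (snd z)))) \<partial>joint2 n) =
    (\<integral>\<^sup>+q. \<integral>\<^sup>+y. \<integral>\<^sup>+w. ennreal (lik n (snd q) y) * ?f (fst q, y, w) \<partial>std_cgauss \<partial>std_cgauss \<partial>p)"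
    by (subst nn_integral_joint2, measurable, intro nn_integral_cong)
       (simp add: ennreal_mult[symmetric] nn divide_inverse mult.commute mult.left_commute)
  also have "\<dots> = (\<integral>\<^sup>+q. \<integral>\<^sup>+y. \<integral>\<^sup>+w. ennreal (D (fst q, y)) * ?f (fst q, y, w) \<partial>std_cgauss \<partial>std_cgauss \<partial>p)"
    by (rule cond_densityD2[OF D]) measurable
  also have "\<dots> \<le> (\<integral>\<^sup>+q. \<integral>\<^sup>+y. \<integral>\<^sup>+w. ennreal (out n y) * ?c (fst q) (a *\<^sub>R y + b *\<^sub>R w) \<partial>std_cgauss \<partial>std_cgauss \<partial>p)"
  proof (intro nn_integral_mono)
    fix q y w
    show "ennreal (D (fst q, y)) * ?f (fst q, y, w) \<le> ennreal (out n y) * ?c (fst q) (a *\<^sub>R y + b *\<^sub>R w)"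
      by (cases "D (fst q, y) = 0") (simp_all add: ennreal_mult[symmetric] nn field_simps)
  qed
  also have "\<dots> = (\<integral>\<^sup>+q. \<integral>\<^sup>+y. \<integral>\<^sup>+w. ennreal (out n (a *\<^sub>R y + b *\<^sub>R w)) * ?c (fst q) y \<partial>std_cgauss \<partial>std_cgauss \<partial>p)"
    using nn_integral_reflection[of "\<lambda>(q, y, w). ennreal (out n y) * ?c (fst q) (a *\<^sub>R y + b *\<^sub>R w)", OF _ ab]
    by (simp add: reflection_involution[OF ab])
  also have "\<dots> = (\<integral>\<^sup>+q. \<integral>\<^sup>+y. ennreal (out m y) * ?c (fst q) y \<partial>std_cgauss \<partial>p)"
    by (intro nn_integral_cong) (simp add: nn_integral_multc nn_integral_out_reflection[OF ab] m)
  also have "\<dots> = (\<integral>\<^sup>+q. \<integral>\<^sup>+y. ennreal (D' (fst q, y)) \<partial>std_cgauss \<partial>p)"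
    by (intro nn_integral_cong) (simp add: ennreal_mult[symmetric] nn out_pos[THEN less_imp_neq, symmetric])
  finally show ?thesis by (simp add: nn_integral_cond_density[OF D'])
qed

text \<open>Almost everywhere \<open>T = ln r1 + ln r2 + (g n - g m)\<close> and also
  \<open>T = - ln r3\<close>. Bounding each logarithm of a ratio by the ratio minus 1 encloses
  \<open>T\<close> between two integrable functions, so integrability needs no separate
  argument.\<close>

lemma degradation_integrand:
  defines "T \<equiv> \<lambda>z. ln (D (fst (fst z), fst (snd z)) / out n (fst (snd z))) -
      ln (D' (fst (fst z), degraded (snd z)) / out m (degraded (snd z)))"
  shows "integrable (joint2 n) T" and "0 \<le> integral\<^sup>L (joint2 n) T"
    and "integral\<^sup>L (joint2 n) T \<le>
      (n\<^sup>2 * (power - P) / (1 + P * n\<^sup>2) + ln (1 + P * n\<^sup>2)) - (m\<^sup>2 * (power - P) / (1 + P * m\<^sup>2) + ln (1 + P * m\<^sup>2))"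
proof -
  interpret J: prob_space "joint2 n" by (rule prob_space_joint2)
  note nn = cond_density_nonneg[OF D] cond_density_nonneg[OF D']
  note G = gauss_out_pos[OF P_pos]
  define r1 where "r1 = (\<lambda>z :: ('u \<times> complex) \<times> complex \<times> complex. D (fst (fst z), fst (snd z)) * lik m (snd (fst z)) (degraded (snd z)) /
      (D' (fst (fst z), degraded (snd z)) * lik n (snd (fst z)) (fst (snd z))))"
  define r2 where "r2 = (\<lambda>z :: ('u \<times> complex) \<times> complex \<times> complex. gauss_out P n (fst (snd z)) * out m (degraded (snd z)) /
      (gauss_out P m (degraded (snd z)) * out n (fst (snd z))))"
  define r3 where "r3 = (\<lambda>z :: ('u \<times> complex) \<times> complex \<times> complex. out n (fst (snd z)) * D' (fst (fst z), degraded (snd z)) /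
      (D (fst (fst z), fst (snd z)) * out m (degraded (snd z))))"
  define g where "g = (\<lambda>k (z :: ('u \<times> complex) \<times> complex). ln (lik k (snd (fst z)) (snd z)) - ln (gauss_out P k (snd z)))"
  define \<psi> where "\<psi> k = k\<^sup>2 * (power - P) / (1 + P * k\<^sup>2) + ln (1 + P * k\<^sup>2)" for k
  have [measurable]: "T \<in> borel_measurable (joint2 n)" unfolding T_def by measurable
  have r1: "integrable (joint2 n) r1" "integral\<^sup>L (joint2 n) r1 \<le> 1"
  proof -
    have "r1 \<in> borel_measurable (joint2 n)" unfolding r1_def by measurable
    moreover have "0 \<le> r1 z" for z by (simp add: r1_def nn)
    moreover have "(\<integral>\<^sup>+z. ennreal (r1 z) \<partial>joint2 n) \<le> 1" unfolding r1_def by (rule likelihood_ratio_le_1)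
    ultimately show "integrable (joint2 n) r1" "integral\<^sup>L (joint2 n) r1 \<le> 1"
      by (rule integrable_le_1)+
  qed
  have r2: "integrable (joint2 n) r2" "integral\<^sup>L (joint2 n) r2 \<le> 1"
  proof -
    have "r2 \<in> borel_measurable (joint2 n)" unfolding r2_def by measurable
    moreover have "0 \<le> r2 z" for z by (simp add: r2_def G less_imp_le)
    moreover have "(\<integral>\<^sup>+z. ennreal (r2 z) \<partial>joint2 n) \<le> 1" unfolding r2_def by (rule output_ratio_le_1)
    ultimately show "integrable (joint2 n) r2" "integral\<^sup>L (joint2 n) r2 \<le> 1"
      by (rule integrable_le_1)+
  qed
  have r3: "integrable (joint2 n) r3" "integral\<^sup>L (joint2 n) r3 \<le> 1"
  proof -
    have "r3 \<in> borel_measurable (joint2 n)" unfolding r3_def by measurable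
    moreover have "0 \<le> r3 z" for z by (simp add: r3_def nn)
    moreover have "(\<integral>\<^sup>+z. ennreal (r3 z) \<partial>joint2 n) \<le> 1" unfolding r3_def by (rule inverse_ratio_le_1)
    ultimately show "integrable (joint2 n) r3" "integral\<^sup>L (joint2 n) r3 \<le> 1"
      by (rule integrable_le_1)+
  qed
  have g_n: "has_bochner_integral (joint2 n) (\<lambda>z. g n (fst z, fst (snd z))) (\<psi> n)"
  proof -
    have "has_bochner_integral (distr (joint2 n) (p \<Otimes>\<^sub>M borel) (\<lambda>z. (fst z, fst (snd z)))) (g n) (\<psi> n)"
      unfolding distr_joint2_fst g_def \<psi>_def by (rule has_bochner_integral_joint_log_ratio)
    then show ?thesis
      by (simp add: has_bochner_integral_iff integrable_distr_eq integral_distr g_def)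
  qed
  have g_m: "has_bochner_integral (joint2 n) (\<lambda>z. g m (fst z, degraded (snd z))) (\<psi> m)"
  proof -
    have "has_bochner_integral (distr (joint2 n) (p \<Otimes>\<^sub>M borel) (\<lambda>z. (fst z, degraded (snd z)))) (g m) (\<psi> m)"
      unfolding distr_joint2_degraded[OF ab] m[symmetric] g_def \<psi>_def by (rule has_bochner_integral_joint_log_ratio)
    then show ?thesis
      by (simp add: has_bochner_integral_iff integrable_distr_eq integral_distr g_def)
  qed
  have g: "has_bochner_integral (joint2 n) (\<lambda>z. g n (fst z, fst (snd z)) - g m (fst z, degraded (snd z))) (\<psi> n - \<psi> m)"
    by (rule has_bochner_integral_diff[OF g_n g_m])
  \<comment> \<open>The two ratio terms have expectation at most 0, so only the explicit Gaussian
    expression remains after integration.\<close>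
  define ub where "ub = (\<lambda>z. (r1 z - 1) + (r2 z - 1) + (g n (fst z, fst (snd z)) - g m (fst z, degraded (snd z))))"
  have ub: "integrable (joint2 n) ub" "integral\<^sup>L (joint2 n) ub \<le> \<psi> n - \<psi> m"
    using r1 r2 g unfolding ub_def has_bochner_integral_iff by (simp_all add: J.prob_space)
  have lb: "integrable (joint2 n) (\<lambda>z. 1 - r3 z)" "0 \<le> (\<integral>z. 1 - r3 z \<partial>joint2 n)"
    using r3 by (simp_all add: J.prob_space)
  have "AE z in joint n. 0 < D (fst (fst z), snd z)"
    by (rule AE_cond_density_pos[OF D])
  then have pos: "AE z in joint2 n. 0 < D (fst (fst z), fst (snd z))"
    unfolding distr_joint2_fst[symmetric] by (subst (asm) AE_distr_iff) simp_all
  have "AE z in joint m. 0 < D' (fst (fst z), snd z)"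
    by (rule AE_cond_density_pos[OF D'])
  then have pos': "AE z in joint2 n. 0 < D' (fst (fst z), degraded (snd z))"
    unfolding m distr_joint2_degraded[OF ab, symmetric] by (subst (asm) AE_distr_iff) simp_all
  have le: "AE z in joint2 n. T z \<le> ub z" and ge: "AE z in joint2 n. 1 - r3 z \<le> T z"
  proof -
    have *: "T z \<le> ub z \<and> 1 - r3 z \<le> T z"
      if z: "0 < D (fst (fst z), fst (snd z))" "0 < D' (fst (fst z), degraded (snd z))" for z
    proof -
      have nz: "out k y \<noteq> 0" "gauss_out P k y \<noteq> 0" for k y
        using out_pos[of k y] G[of k y] by (metis less_irrefl)+
      have "ln (r1 z) + ln (r2 z) + (g n (fst z, fst (snd z)) - g m (fst z, degraded (snd z))) = T z"
        using z by (simp add: r1_def r2_def g_def T_def ln_div ln_mult nz)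
      moreover have "ln (r1 z) \<le> r1 z - 1" "ln (r2 z) \<le> r2 z - 1"
        using z by (intro ln_le_minus_one; simp add: r1_def r2_def G)+
      moreover have "ln (r3 z) = - T z"
        using z by (simp add: r3_def T_def ln_div ln_mult nz)
      moreover have "ln (r3 z) \<le> r3 z - 1"
        using z by (intro ln_le_minus_one) (simp add: r3_def)
      ultimately show ?thesis unfolding ub_def by linarith
    qed
    show "AE z in joint2 n. T z \<le> ub z" using pos pos' by eventually_elim (use * in blast)
    show "AE z in joint2 n. 1 - r3 z \<le> T z" using pos pos' by eventually_elim (use * in blast)
  qed
  \<comment> \<open>The lower and the upper bound together dominate \<open>T\<close> in absolute
    value.\<close>
  show int: "integrable (joint2 n) T"
  proof (rule Bochner_Integration.integrable_bound)
    show "integrable (joint2 n) (\<lambda>z. \<bar>ub z\<bar> + \<bar>1 - r3 z\<bar>)" using ub lb by simp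
    show "AE z in joint2 n. norm (T z) \<le> norm (\<bar>ub z\<bar> + \<bar>1 - r3 z\<bar>)"
      using le ge by eventually_elim auto
  qed measurable
  have "(\<integral>z. 1 - r3 z \<partial>joint2 n) \<le> integral\<^sup>L (joint2 n) T"
    by (rule integral_mono_AE[OF lb(1) int ge])
  then show "0 \<le> integral\<^sup>L (joint2 n) T" using lb(2) by linarith
  have "integral\<^sup>L (joint2 n) T \<le> integral\<^sup>L (joint2 n) ub"
    by (rule integral_mono_AE[OF int ub(1) le])
  then show "integral\<^sup>L (joint2 n) T \<le>
      (n\<^sup>2 * (power - P) / (1 + P * n\<^sup>2) + ln (1 + P * n\<^sup>2)) - (m\<^sup>2 * (power - P) / (1 + P * m\<^sup>2) + ln (1 + P * m\<^sup>2))"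
    using ub(2) unfolding \<psi>_def by linarith
qed

end

text \<open>Comparison with gain 0 (\<open>a = 0\<close>, \<open>b = 1\<close>): there both
  \<open>D'\<close> and \<open>out\<close> are 1, the second logarithm vanishes, and
  \<open>T\<close> is the logarithm in question.\<close>

lemma integrable_joint_log_density:
  assumes D: "cond_density n D"
  shows "integrable (joint n) (\<lambda>z. ln (D (fst (fst z), snd z) / out n (snd z)))"
proof -
  note [measurable] = cond_density_measurable[OF D]
  have "integrable (joint2 n) (\<lambda>z. ln (D (fst (fst z), fst (snd z)) / out n (fst (snd z))))"
    using degradation_integrand(1)[OF _ _ D cond_density_0, of 0 1] by simp
  then have "integrable (distr (joint2 n) (p \<Otimes>\<^sub>M borel) (\<lambda>z. (fst z, fst (snd z))))
      (\<lambda>z. ln (D (fst (fst z), snd z) / out n (snd z)))"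
    by (subst integrable_distr_eq) simp_all
  then show ?thesis by (simp add: distr_joint2_fst)
qed

lemma power_ratio_mono:
  assumes "0 \<le> m" "m \<le> n"
  shows "n\<^sup>2 * (power - P) / (1 + P * n\<^sup>2) \<le> m\<^sup>2 * (power - P) / (1 + P * m\<^sup>2)"
proof -
  have pos: "1 + P * k\<^sup>2 > 0" for k using P_pos by (intro add_pos_nonneg) auto
  have "m\<^sup>2 / (1 + P * m\<^sup>2) \<le> n\<^sup>2 / (1 + P * n\<^sup>2)"
    using pos[of m] pos[of n] assms by (simp add: divide_simps algebra_simps power_mono)
  from mult_right_mono_neg[OF this, of "power - P"] show ?thesis using power_le by simp
qed

text \<open>The mutual information between \<open>u\<close> and \<open>n x + w\<close>, in nats.\<close>

definition scalar_MI :: "real \<Rightarrow> ('u \<times> complex \<Rightarrow> real) \<Rightarrow> real" where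
  "scalar_MI n D = (\<integral>z. ln (D (fst (fst z), snd z) / out n (snd z)) \<partial>joint n)"

text \<open>The two logarithms in the integrand of \<open>degradation_integrand\<close> live on two
  marginals of \<open>joint2 n\<close>, namely the channels of gain \<open>n\<close> and
  \<open>m\<close>. Each is integrable on its own by the comparison with gain 0, so the integral
  splits into the two informations.\<close>

proposition scalar_MI_diff:
  assumes mn: "0 \<le> m" "m \<le> n" and D: "cond_density n D" and D': "cond_density m D'"
  shows "scalar_MI m D' \<le> scalar_MI n D"
    and "scalar_MI n D - scalar_MI m D' \<le> ln ((1 + P * n\<^sup>2) / (1 + P * m\<^sup>2))"
proof -
  note [measurable] = cond_density_measurable[OF D] cond_density_measurable[OF D']
  define a where "a = (if n = 0 then 1 else m / n)"
  define b where "b = sqrt (1 - a\<^sup>2)"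
  have a: "0 \<le> a" "a \<le> 1" "m = n * a" using mn by (auto simp: a_def)
  have ab: "a\<^sup>2 + b\<^sup>2 = 1" using a by (simp add: b_def power_le_one)
  let ?T1 = "\<lambda>z. ln (D (fst (fst z), fst (snd z)) / out n (fst (snd z)))"
  let ?T2 = "\<lambda>z. ln (D' (fst (fst z), a *\<^sub>R fst (snd z) + b *\<^sub>R snd (snd z)) / out m (a *\<^sub>R fst (snd z) + b *\<^sub>R snd (snd z)))"
  have T1: "has_bochner_integral (joint2 n) ?T1 (scalar_MI n D)"
  proof -
    have "has_bochner_integral (distr (joint2 n) (p \<Otimes>\<^sub>M borel) (\<lambda>z. (fst z, fst (snd z))))
        (\<lambda>z. ln (D (fst (fst z), snd z) / out n (snd z))) (scalar_MI n D)"
      unfolding distr_joint2_fst has_bochner_integral_iff scalar_MI_def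
      by (simp add: integrable_joint_log_density[OF D])
    then show ?thesis by (simp add: has_bochner_integral_iff integrable_distr_eq integral_distr)
  qed
  have T2: "has_bochner_integral (joint2 n) ?T2 (scalar_MI m D')"
  proof -
    have "has_bochner_integral (distr (joint2 n) (p \<Otimes>\<^sub>M borel) (\<lambda>z. (fst z, a *\<^sub>R fst (snd z) + b *\<^sub>R snd (snd z))))
        (\<lambda>z. ln (D' (fst (fst z), snd z) / out m (snd z))) (scalar_MI m D')"
      unfolding distr_joint2_degraded[OF ab] a(3)[symmetric] has_bochner_integral_iff scalar_MI_def
      by (simp add: integrable_joint_log_density[OF D'])
    then show ?thesis by (simp add: has_bochner_integral_iff integrable_distr_eq integral_distr)
  qed
  have T: "(\<integral>z. ?T1 z - ?T2 z \<partial>joint2 n) = scalar_MI n D - scalar_MI m D'"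
    using has_bochner_integral_diff[OF T1 T2] by (simp add: has_bochner_integral_iff)
  note * = degradation_integrand[OF ab a(3) D D', unfolded T]
  show "scalar_MI m D' \<le> scalar_MI n D" using *(2) by linarith
  have pos: "1 + P * k\<^sup>2 > 0" for k using P_pos by (intro add_pos_nonneg) auto
  have "ln ((1 + P * n\<^sup>2) / (1 + P * m\<^sup>2)) = ln (1 + P * n\<^sup>2) - ln (1 + P * m\<^sup>2)"
    using pos[of n] pos[of m] by (simp add: ln_div)
  then show "scalar_MI n D - scalar_MI m D' \<le> ln ((1 + P * n\<^sup>2) / (1 + P * m\<^sup>2))"
    using *(3) power_ratio_mono[OF mn] by linarith
qed

end

section \<open>Vector channels\<close>

lemma measure_eqI_pair:
  assumes "finite_measure M" and M: "sets M = sets (A \<Otimes>\<^sub>M B)" and N: "sets N = sets (A \<Otimes>\<^sub>M B)"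
    and eq: "\<And>X Y. X \<in> sets A \<Longrightarrow> Y \<in> sets B \<Longrightarrow> emeasure M (X \<times> Y) = emeasure N (X \<times> Y)"
  shows "M = N"
proof -
  interpret finite_measure M by fact
  let ?E = "{X \<times> Y | X Y. X \<in> sets A \<and> Y \<in> sets B}"
  show ?thesis
  proof (rule measure_eqI_generator_eq[where E = ?E and \<Omega> = "space A \<times> space B" and A = "\<lambda>_. space A \<times> space B"])
    show "Int_stable ?E" by (rule Int_stable_pair_measure_generator)
    show "?E \<subseteq> Pow (space A \<times> space B)"
      using sets.space_closed[of A] sets.space_closed[of B] by auto
    show "sets M = sigma_sets (space A \<times> space B) ?E" "sets N = sigma_sets (space A \<times> space B) ?E"
      unfolding M N by (rule sets_pair_measure)+
    show "emeasure M X = emeasure N X" if "X \<in> ?E" for X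
      using that eq by auto
    show "range (\<lambda>_::nat. space A \<times> space B) \<subseteq> ?E" by auto
    show "(\<Union>i::nat. space A \<times> space B) = space A \<times> space B" by simp
    show "emeasure M (space A \<times> space B) \<noteq> \<infinity>" by simp
  qed
qed

context power_limited_input
begin

lemma prob_space_p: "prob_space p" by (rule prob_space_axioms)

text \<open>Uniqueness of densities turns the integrated identity for \<open>D\<close> into one for
  almost every scalar output, and this can be pulled back along a projection of the noise vector.
  The exceptional null set depends on \<open>A\<close>, so the identity of vector laws below is
  checked on rectangles.\<close>

lemma AE_conditional_expectation_eq:
  assumes D: "cond_density n D" and [measurable]: "A \<in> sets U"
  shows "AE y in std_cgauss. (\<integral>\<^sup>+q. ennreal (lik n (snd q) y) * indicator A (fst q) \<partial>p) =
    (\<integral>\<^sup>+q. ennreal (D (fst q, y)) * indicator A (fst q) \<partial>p)"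
proof -
  note [measurable] = cond_density_measurable[OF D]
  let ?f = "\<lambda>y. \<integral>\<^sup>+q. ennreal (lik n (snd q) y) * indicator A (fst q) \<partial>p"
  let ?g = "\<lambda>y. \<integral>\<^sup>+q. ennreal (D (fst q, y)) * indicator A (fst q) \<partial>p"
  have swap: "(\<integral>\<^sup>+y. (\<integral>\<^sup>+q. c q y * indicator A (fst q) \<partial>p) * indicator B y \<partial>std_cgauss) =
      (\<integral>\<^sup>+q. \<integral>\<^sup>+y. c q y * (\<lambda>(u, y). indicator A u * indicator B y) (fst q, y) \<partial>std_cgauss \<partial>p)"
    if [measurable]: "case_prod c \<in> borel_measurable (p \<Otimes>\<^sub>M borel)" "B \<in> sets borel" for c B
  proof -
    have "(\<integral>\<^sup>+y. (\<integral>\<^sup>+q. c q y * indicator A (fst q) \<partial>p) * indicator B y \<partial>std_cgauss) =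
        (\<integral>\<^sup>+y. \<integral>\<^sup>+q. c q y * indicator A (fst q) * indicator B y \<partial>p \<partial>std_cgauss)"
      by (intro nn_integral_cong nn_integral_multc[symmetric]) measurable
    also have "\<dots> = (\<integral>\<^sup>+q. \<integral>\<^sup>+y. c q y * indicator A (fst q) * indicator B y \<partial>std_cgauss \<partial>p)"
      by (rule pn.Fubini') measurable
    finally show ?thesis by (simp add: mult.assoc)
  qed
  have "density std_cgauss ?f = density std_cgauss ?g"
  proof (rule measure_eqI)
    fix B assume "B \<in> sets (density std_cgauss ?f)"
    then have [measurable]: "B \<in> sets borel" by simp
    have "emeasure (density std_cgauss ?f) B =
        (\<integral>\<^sup>+q. \<integral>\<^sup>+y. ennreal (lik n (snd q) y) * (\<lambda>(u, y). indicator A u * indicator B y) (fst q, y) \<partial>std_cgauss \<partial>p)"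
      by (subst swap[symmetric], measurable, rule emeasure_density) measurable
    also have "\<dots> = (\<integral>\<^sup>+q. \<integral>\<^sup>+y. ennreal (D (fst q, y)) * (\<lambda>(u, y). indicator A u * indicator B y) (fst q, y) \<partial>std_cgauss \<partial>p)"
      by (rule cond_densityD[OF D]) measurable
    also have "\<dots> = emeasure (density std_cgauss ?g) B"
      by (subst swap[symmetric], measurable, rule emeasure_density[symmetric]) measurable
    finally show "emeasure (density std_cgauss ?f) B = emeasure (density std_cgauss ?g) B" .
  qed simp
  then show ?thesis by (intro std_cgauss.density_unique) measurable
qed

context
  fixes h :: "complex ^ 'n::finite" and c :: "'n \<Rightarrow> complex"
  assumes c1: "(\<Sum>i\<in>UNIV. (cmod (c i))\<^sup>2) = 1" and ch: "\<And>i. of_real (norm h) * c i = cnj (h $ i)"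
begin

text \<open>The component of the output along \<open>h\<close>, a sufficient statistic.\<close>

definition proj :: "complex ^ 'n \<Rightarrow> complex" where
  "proj v = (\<Sum>i\<in>UNIV. c i * v $ i)"

abbreviation noise :: "(complex ^ 'n) measure" where
  "noise \<equiv> cgauss_noise"

lemma borel_measurable_proj [measurable]: "proj \<in> borel \<rightarrow>\<^sub>M borel"
  unfolding proj_def by measurable

lemma proj_output: "proj (x *s h + w) = norm h *\<^sub>R x + proj w"
proof -
  have "(\<Sum>i\<in>UNIV. c i * h $ i) = of_real (norm h)"
  proof (cases "h = 0")
    case False
    \<comment> \<open>The coefficients are known only after multiplication by \<open>norm h\<close>;
      the identity is proved in that form and then divided.\<close>
    have "of_real (norm h) * (\<Sum>i\<in>UNIV. c i * h $ i) = (\<Sum>i\<in>UNIV. cnj (h $ i) * h $ i)"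
      by (simp only: sum_distrib_left mult.assoc[symmetric] ch)
    also have "\<dots> = of_real (\<Sum>i\<in>UNIV. (cmod (h $ i))\<^sup>2)"
      by (simp add: complex_norm_square mult.commute del: of_real_power)
    also have "(\<Sum>i\<in>UNIV. (cmod (h $ i))\<^sup>2) = (norm h)\<^sup>2"
      by (simp add: norm_vec_def L2_set_def sum_nonneg)
    finally show ?thesis using False by (simp add: power2_eq_square)
  qed simp
  then have "(\<Sum>i\<in>UNIV. c i * (x * h $ i)) = norm h *\<^sub>R x"
    by (simp add: sum_distrib_left[symmetric] scaleR_conv_of_real mult.left_commute[of _ x] mult.commute)
  then show ?thesis by (simp add: proj_def sum.distrib distrib_left)
qed

lemma distr_proj: "distr noise borel proj = std_cgauss"
proof (rule measure_eqI_nn_integral)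
  fix f :: "complex \<Rightarrow> ennreal" assume "f \<in> borel_measurable (distr noise borel proj)"
  then have [measurable]: "f \<in> borel_measurable borel" by simp
  show "integral\<^sup>N (distr noise borel proj) f = integral\<^sup>N std_cgauss f"
    using nn_integral_cgauss_noise_sum[OF \<open>f \<in> borel_measurable borel\<close> c1]
    by (simp add: nn_integral_distr proj_def)
qed simp

lemma translate:
  assumes "f \<in> borel_measurable borel"
  shows "(\<integral>\<^sup>+w. f (x *s h + w) \<partial>noise) = (\<integral>\<^sup>+v. ennreal (lik (norm h) x (proj v)) * f v \<partial>noise)"
  unfolding proj_def by (rule nn_integral_cgauss_noise_translate[OF assms ch])

lemma measurable_output [measurable]:
  "(\<lambda>z. snd (fst z) *s h + snd z) \<in> p \<Otimes>\<^sub>M noise \<rightarrow>\<^sub>M borel"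
proof -
  have "(\<lambda>q :: complex \<times> (complex ^ 'n). fst q *s h + snd q) \<in> borel_measurable borel"
    unfolding vector_scalar_mult_def
    by (intro borel_measurable_continuous_onI continuous_intros)
  then have [measurable]: "(\<lambda>q. fst q *s h + snd q) \<in> (borel :: complex measure) \<Otimes>\<^sub>M borel \<rightarrow>\<^sub>M borel"
    by (simp add: borel_prod)
  have "(\<lambda>z. (\<lambda>q. fst q *s h + snd q) (snd (fst z), snd z)) \<in> p \<Otimes>\<^sub>M noise \<rightarrow>\<^sub>M borel"
    by measurable
  then show ?thesis by simp
qed

lemma prob_space_noise: "prob_space noise"
  by (rule prob_space_cgauss_noise)

lemma pair_prob_space_noise: "pair_prob_space p noise"
  by (intro pair_prob_space.intro pair_sigma_finite.intro prob_space_imp_sigma_finite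
      prob_space_noise prob_space_axioms)

lemma prob_space_p_noise: "prob_space (p \<Otimes>\<^sub>M noise)"
proof -
  interpret pair_prob_space p noise by (rule pair_prob_space_noise)
  show ?thesis by (rule P.prob_space_axioms)
qed

lemma distr_proj_output:
  "distr (p \<Otimes>\<^sub>M noise) (p \<Otimes>\<^sub>M borel) (\<lambda>z. (fst z, proj (snd (fst z) *s h + snd z))) = joint (norm h)"
proof -
  interpret noise: prob_space noise by (rule prob_space_noise)
  show ?thesis
  proof (rule measure_eqI_nn_integral)
    fix f :: "_ \<Rightarrow> ennreal"
    assume "f \<in> borel_measurable (distr (p \<Otimes>\<^sub>M noise) (p \<Otimes>\<^sub>M borel) (\<lambda>z. (fst z, proj (snd (fst z) *s h + snd z))))"
    then have [measurable]: "f \<in> borel_measurable (p \<Otimes>\<^sub>M borel)" by simp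
    have "integral\<^sup>N (distr (p \<Otimes>\<^sub>M noise) (p \<Otimes>\<^sub>M borel) (\<lambda>z. (fst z, proj (snd (fst z) *s h + snd z)))) f =
        (\<integral>\<^sup>+q. \<integral>\<^sup>+w. f (q, norm h *\<^sub>R snd q + proj w) \<partial>noise \<partial>p)"
      by (subst nn_integral_distr) (simp_all add: proj_output noise.nn_integral_fst[symmetric])
    also have "\<dots> = (\<integral>\<^sup>+q. \<integral>\<^sup>+y. f (q, norm h *\<^sub>R snd q + y) \<partial>std_cgauss \<partial>p)"
      by (intro nn_integral_cong) (simp add: distr_proj[symmetric] nn_integral_distr)
    also have "\<dots> = integral\<^sup>N (joint (norm h)) f"
      unfolding joint_eq_distr by (subst nn_integral_distr) (simp_all add: std_cgauss.nn_integral_fst[symmetric])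
    finally show "integral\<^sup>N (distr (p \<Otimes>\<^sub>M noise) (p \<Otimes>\<^sub>M borel) (\<lambda>z. (fst z, proj (snd (fst z) *s h + snd z)))) f =
      integral\<^sup>N (joint (norm h)) f" .
  qed (simp add: sets_joint)
qed

text \<open>By \<open>translate\<close> the likelihood sees the vector output only through
  \<open>proj\<close>; Fubini then averages it over the input to \<open>out\<close>.\<close>

lemma distr_output:
  "distr (p \<Otimes>\<^sub>M noise) borel (\<lambda>z. snd (fst z) *s h + snd z) = density noise (\<lambda>v. ennreal (out (norm h) (proj v)))"
proof -
  interpret pair_prob_space p noise by (rule pair_prob_space_noise)
  show ?thesis
  proof (rule measure_eqI_nn_integral)
    fix f :: "_ \<Rightarrow> ennreal"
    assume "f \<in> borel_measurable (distr (p \<Otimes>\<^sub>M noise) borel (\<lambda>z. snd (fst z) *s h + snd z))"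
    then have [measurable]: "f \<in> borel_measurable borel" by simp
    have "integral\<^sup>N (distr (p \<Otimes>\<^sub>M noise) borel (\<lambda>z. snd (fst z) *s h + snd z)) f =
        (\<integral>\<^sup>+q. \<integral>\<^sup>+w. f (snd q *s h + w) \<partial>noise \<partial>p)"
      by (subst nn_integral_distr) (simp_all add: M2.nn_integral_fst[symmetric])
    also have "\<dots> = (\<integral>\<^sup>+q. \<integral>\<^sup>+v. ennreal (lik (norm h) (snd q) (proj v)) * f v \<partial>noise \<partial>p)"
      by (simp add: translate)
    also have "\<dots> = (\<integral>\<^sup>+v. \<integral>\<^sup>+q. ennreal (lik (norm h) (snd q) (proj v)) * f v \<partial>p \<partial>noise)"
      by (rule Fubini'[symmetric]) measurable
    also have "\<dots> = integral\<^sup>N (density noise (\<lambda>v. ennreal (out (norm h) (proj v)))) f"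
      by (subst nn_integral_density) (simp_all add: nn_integral_multc ennreal_out)
    finally show "integral\<^sup>N (distr (p \<Otimes>\<^sub>M noise) borel (\<lambda>z. snd (fst z) *s h + snd z)) f =
      integral\<^sup>N (density noise (\<lambda>v. ennreal (out (norm h) (proj v)))) f" .
  qed simp
qed

text \<open>On a rectangle, Fubini isolates the average of the likelihood over the inputs with
  message in \<open>A\<close>, a function of \<open>proj v\<close> alone. It may be replaced by the
  average of \<open>D\<close>, because \<open>proj\<close> carries the vector noise to the scalar
  noise and hence preserves null sets.\<close>

lemma distr_message_output:
  assumes D: "cond_density (norm h) D"
  shows "distr (p \<Otimes>\<^sub>M noise) (U \<Otimes>\<^sub>M borel) (\<lambda>z. (fst (fst z), snd (fst z) *s h + snd z)) =
    density (distr p U fst \<Otimes>\<^sub>M noise) (\<lambda>z. ennreal (D (fst z, proj (snd z))))"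
proof -
  note [measurable] = cond_density_measurable[OF D]
  interpret pair_prob_space p noise by (rule pair_prob_space_noise)
  show ?thesis
  proof (rule measure_eqI_pair)
    show "finite_measure (distr (p \<Otimes>\<^sub>M noise) (U \<Otimes>\<^sub>M borel) (\<lambda>z. (fst (fst z), snd (fst z) *s h + snd z)))"
      by (rule prob_space.axioms(1)[OF prob_space.prob_space_distr[OF prob_space_p_noise]]) measurable
    show "sets (density (distr p U fst \<Otimes>\<^sub>M noise) (\<lambda>z. ennreal (D (fst z, proj (snd z))))) =
        sets (U \<Otimes>\<^sub>M (borel :: (complex ^ 'n) measure))"
      by (simp cong: sets_pair_measure_cong)
    fix A :: "'u set" and B :: "(complex ^ 'n) set"
    assume [measurable]: "A \<in> sets U" "B \<in> sets borel"
    let ?i = "\<lambda>u v. indicator A u * indicator B v :: ennreal"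
    have ind: "indicator (A \<times> B) (u, v) = ?i u v" for u v
      by (simp add: indicator_def)
    have "emeasure (distr (p \<Otimes>\<^sub>M noise) (U \<Otimes>\<^sub>M borel) (\<lambda>z. (fst (fst z), snd (fst z) *s h + snd z))) (A \<times> B) =
        (\<integral>\<^sup>+z. indicator (A \<times> B) z \<partial>distr (p \<Otimes>\<^sub>M noise) (U \<Otimes>\<^sub>M borel) (\<lambda>z. (fst (fst z), snd (fst z) *s h + snd z)))"
      by simp
    also have "\<dots> = (\<integral>\<^sup>+z. ?i (fst (fst z)) (snd (fst z) *s h + snd z) \<partial>(p \<Otimes>\<^sub>M noise))"
      by (subst nn_integral_distr) (simp_all add: ind)
    also have "\<dots> = (\<integral>\<^sup>+q. \<integral>\<^sup>+w. ?i (fst q) (snd q *s h + w) \<partial>noise \<partial>p)"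
      by (subst M2.nn_integral_fst[symmetric]) simp_all
    also have "\<dots> = (\<integral>\<^sup>+q. \<integral>\<^sup>+v. ennreal (lik (norm h) (snd q) (proj v)) * ?i (fst q) v \<partial>noise \<partial>p)"
      by (rule nn_integral_cong, rule translate) measurable
    also have "\<dots> = (\<integral>\<^sup>+v. \<integral>\<^sup>+q. ennreal (lik (norm h) (snd q) (proj v)) * ?i (fst q) v \<partial>p \<partial>noise)"
      by (rule Fubini'[symmetric]) measurable
    also have "\<dots> = (\<integral>\<^sup>+v. (\<integral>\<^sup>+q. ennreal (lik (norm h) (snd q) (proj v)) * indicator A (fst q) \<partial>p) * indicator B v \<partial>noise)"
      by (intro nn_integral_cong) (simp add: nn_integral_multc mult.assoc[symmetric])
    also have "\<dots> = (\<integral>\<^sup>+v. (\<integral>\<^sup>+q. ennreal (D (fst q, proj v)) * indicator A (fst q) \<partial>p) * indicator B v \<partial>noise)"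
    proof (rule nn_integral_cong_AE)
      have "AE y in distr noise borel proj. (\<integral>\<^sup>+q. ennreal (lik (norm h) (snd q) y) * indicator A (fst q) \<partial>p) =
          (\<integral>\<^sup>+q. ennreal (D (fst q, y)) * indicator A (fst q) \<partial>p)"
        unfolding distr_proj by (rule AE_conditional_expectation_eq[OF D]) measurable
      then have "AE v in noise. (\<integral>\<^sup>+q. ennreal (lik (norm h) (snd q) (proj v)) * indicator A (fst q) \<partial>p) =
          (\<integral>\<^sup>+q. ennreal (D (fst q, proj v)) * indicator A (fst q) \<partial>p)"
        by (subst (asm) AE_distr_iff) measurable
      then show "AE v in noise. (\<integral>\<^sup>+q. ennreal (lik (norm h) (snd q) (proj v)) * indicator A (fst q) \<partial>p) * indicator B v =
          (\<integral>\<^sup>+q. ennreal (D (fst q, proj v)) * indicator A (fst q) \<partial>p) * indicator B v"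
        by eventually_elim simp
    qed
    also have "\<dots> = (\<integral>\<^sup>+v. \<integral>\<^sup>+q. ennreal (D (fst q, proj v)) * ?i (fst q) v \<partial>p \<partial>noise)"
      by (intro nn_integral_cong) (simp add: nn_integral_multc mult.assoc[symmetric])
    also have "\<dots> = (\<integral>\<^sup>+q. \<integral>\<^sup>+v. ennreal (D (fst q, proj v)) * ?i (fst q) v \<partial>noise \<partial>p)"
      by (rule Fubini') measurable
    also have "\<dots> = (\<integral>\<^sup>+u. \<integral>\<^sup>+v. ennreal (D (u, proj v)) * ?i u v \<partial>noise \<partial>distr p U fst)"
      by (subst nn_integral_distr) measurable
    also have "\<dots> = (\<integral>\<^sup>+z. ennreal (D (fst z, proj (snd z))) * indicator (A \<times> B) z \<partial>(distr p U fst \<Otimes>\<^sub>M noise))"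
      by (subst M2.nn_integral_fst[symmetric]) (simp_all add: ind)
    also have "\<dots> = emeasure (density (distr p U fst \<Otimes>\<^sub>M noise) (\<lambda>z. ennreal (D (fst z, proj (snd z))))) (A \<times> B)"
      by (subst emeasure_density) measurable
    finally show "emeasure (distr (p \<Otimes>\<^sub>M noise) (U \<Otimes>\<^sub>M borel) (\<lambda>z. (fst (fst z), snd (fst z) *s h + snd z))) (A \<times> B) =
      emeasure (density (distr p U fst \<Otimes>\<^sub>M noise) (\<lambda>z. ennreal (D (fst z, proj (snd z))))) (A \<times> B)" .
  qed simp
qed

text \<open>The joint law of message and output and the product of its marginals both have densities
  over the same product of message law and noise. Their quotient depends on the output only through
  \<open>proj\<close>, so the divergence becomes an integral over the scalar channel;
  \<open>ln 2\<close> converts nats to bits.\<close>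

lemma instantaneous_MI_eq_aux:
  assumes D: "cond_density (norm h) D"
  shows "instantaneous_MI U p h = scalar_MI (norm h) D / ln 2"
proof -
  note [measurable] = cond_density_measurable[OF D]
  note nn = cond_density_nonneg[OF D]
  interpret pair_prob_space p noise by (rule pair_prob_space_noise)
  let ?pU = "distr p U fst"
  let ?r = "\<lambda>z. D (fst z, proj (snd z)) / out (norm h) (proj (snd z))"
  interpret pU: prob_space ?pU by (rule prob_space.prob_space_distr[OF prob_space_p]) measurable
  interpret pUn: pair_prob_space ?pU noise ..
  have message: "distr (p \<Otimes>\<^sub>M noise) U (\<lambda>z. fst (fst z)) = ?pU"
  proof -
    have "distr (p \<Otimes>\<^sub>M noise) U (\<lambda>z. fst (fst z)) = distr (distr (p \<Otimes>\<^sub>M noise) p fst) U fst"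
      by (subst distr_distr) (simp_all add: comp_def)
    then show ?thesis by (simp add: M2.distr_pair_fst)
  qed
  have product: "?pU \<Otimes>\<^sub>M density noise (\<lambda>v. ennreal (out (norm h) (proj v))) =
      density (?pU \<Otimes>\<^sub>M noise) (\<lambda>z. ennreal (out (norm h) (proj (snd z))))"
  proof -
    have "prob_space (density noise (\<lambda>v. ennreal (out (norm h) (proj v))))"
      unfolding distr_output[symmetric] by (rule prob_space.prob_space_distr[OF prob_space_p_noise]) measurable
    then have "sigma_finite_measure (density noise (\<lambda>v. ennreal (out (norm h) (proj v))))"
      by (rule prob_space_imp_sigma_finite)
    then have "density ?pU (\<lambda>_. 1) \<Otimes>\<^sub>M density noise (\<lambda>v. ennreal (out (norm h) (proj v))) =
        density (?pU \<Otimes>\<^sub>M noise) (\<lambda>(u, v). 1 * ennreal (out (norm h) (proj v)))"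
      by (intro pair_measure_density M2.sigma_finite_measure_axioms) measurable
    then show ?thesis by (simp add: density_1 split_def)
  qed
  have "instantaneous_MI U p h = KL_divergence 2
      (density (?pU \<Otimes>\<^sub>M noise) (\<lambda>z. ennreal (out (norm h) (proj (snd z)))))
      (density (?pU \<Otimes>\<^sub>M noise) (\<lambda>z. ennreal (D (fst z, proj (snd z)))))"
    unfolding instantaneous_MI_def prob_space.mutual_information_def[OF prob_space_p_noise] split_def
      message distr_output product distr_message_output[OF D] ..
  also have "\<dots> = (\<integral>z. D (fst z, proj (snd z)) * log 2 (?r z) \<partial>(?pU \<Otimes>\<^sub>M noise))"
    \<comment> \<open>Absolute continuity is immediate because \<open>out\<close> has no
      zeros.\<close>
    by (rule pUn.KL_density_density) (use nn out_pos in \<open>auto simp: less_le\<close>)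
  also have "\<dots> = (\<integral>z. log 2 (?r z) \<partial>density (?pU \<Otimes>\<^sub>M noise) (\<lambda>z. ennreal (D (fst z, proj (snd z)))))"
    by (subst integral_density) (simp_all add: nn)
  also have "\<dots> = (\<integral>z. log 2 (D (fst (fst z), proj (snd (fst z) *s h + snd z)) / out (norm h) (proj (snd (fst z) *s h + snd z))) \<partial>(p \<Otimes>\<^sub>M noise))"
    unfolding distr_message_output[OF D, symmetric] by (subst integral_distr) simp_all
  also have "\<dots> = (\<integral>z. log 2 (D (fst (fst z), snd z) / out (norm h) (snd z)) \<partial>joint (norm h))"
    unfolding distr_proj_output[symmetric] by (subst integral_distr) simp_all
  also have "\<dots> = scalar_MI (norm h) D / ln 2"
    by (simp add: log_def scalar_MI_def)
  finally show ?thesis .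
qed

end

proposition instantaneous_MI_eq:
  fixes h :: "complex ^ 'n::finite"
  assumes "cond_density (norm h) D"
  shows "instantaneous_MI U p h = scalar_MI (norm h) D / ln 2"
proof -
  obtain c :: "'n \<Rightarrow> complex" where "(\<Sum>i\<in>UNIV. (cmod (c i))\<^sup>2) = 1" "\<And>i. of_real (norm h) * c i = cnj (h $ i)"
    using exists_conjugate_direction[of h] by blast
  then show ?thesis using assms by (rule instantaneous_MI_eq_aux)
qed

end

section \<open>Comparison of channel vectors and measurability in the channel\<close>

context power_limited_input
begin

text \<open>The vectors may have different dimensions: both informations are first reduced to scalar
  channels, where only the two norms are compared.\<close>

lemma instantaneous_MI_mono:
  fixes h :: "complex ^ 'b::finite" and g :: "complex ^ 'e::finite"
  assumes "norm g \<le> norm h"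
  shows "instantaneous_MI U p g \<le> instantaneous_MI U p h"
    and "instantaneous_MI U p h - instantaneous_MI U p g \<le> log 2 ((1 + P * (norm h)\<^sup>2) / (1 + P * (norm g)\<^sup>2))"
proof -
  obtain D where D: "cond_density (norm h) D" by (rule exists_cond_density)
  obtain D' where D': "cond_density (norm g) D'" by (rule exists_cond_density)
  note diff = scalar_MI_diff[OF norm_ge_zero assms D D']
  show "instantaneous_MI U p g \<le> instantaneous_MI U p h"
    using diff(1) by (simp add: instantaneous_MI_eq[OF D] instantaneous_MI_eq[OF D'] divide_right_mono)
  show "instantaneous_MI U p h - instantaneous_MI U p g \<le> log 2 ((1 + P * (norm h)\<^sup>2) / (1 + P * (norm g)\<^sup>2))"
    using diff(2)
    by (simp add: instantaneous_MI_eq[OF D] instantaneous_MI_eq[OF D'] log_def diff_divide_distrib[symmetric] divide_right_mono)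
qed

text \<open>The conditional density is picked separately for each gain, so nothing is known about
  its dependence on the gain. Monotonicity of the information in the gain gives Borel measurability
  all the same.\<close>

lemma borel_measurable_instantaneous_MI [measurable]:
  "instantaneous_MI U p \<in> borel_measurable (borel :: (complex ^ 'n::finite) measure)"
proof -
  define D where "D n = (SOME D. cond_density n D)" for n
  have D: "cond_density n (D n)" for n
  proof -
    obtain D' where "cond_density n D'" by (rule exists_cond_density)
    then show ?thesis unfolding D_def by (rule someI[of "cond_density n"])
  qed
  \<comment> \<open>Truncation at 0 extends the function monotonically to all reals, as the
    comparison of gains covers only nonnegative ones.\<close>
  define F where "F t = scalar_MI (max 0 t) (D (max 0 t))" for t
  have "mono F"
    unfolding F_def by (intro monoI scalar_MI_diff(1) D) auto
  then have [measurable]: "F \<in> borel_measurable borel" by (rule borel_measurable_mono)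
  have "instantaneous_MI U p = (\<lambda>h :: complex ^ 'n. F (norm h) / ln 2)"
    by (simp add: fun_eq_iff F_def max_def instantaneous_MI_eq[OF D])
  then show ?thesis by simp
qed

end

section \<open>The Gaussian input and the comparison of outage events\<close>

lemma gaussian_input_in_input_distributions:
  assumes P: "P > 0"
  shows "gaussian_input P \<in> input_distributions borel P"
proof -
  have "prob_space (gaussian_input P)"
    unfolding gaussian_input_def by (rule prob_space.prob_space_distr[OF prob_space_cgauss[OF P]]) measurable
  moreover have "(\<integral>\<^sup>+q. ennreal ((cmod (snd q))\<^sup>2) \<partial>gaussian_input P) = ennreal P"
    unfolding gaussian_input_def
    by (subst nn_integral_distr) (simp_all add: nn_integral_cgauss_second_moment[OF P])
  ultimately show ?thesis
    by (simp add: input_distributions_def) (simp add: gaussian_input_def)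
qed

lemma instantaneous_MI_gaussian_input:
  fixes h :: "complex ^ 'n::finite"
  assumes P: "P > 0"
  shows "instantaneous_MI borel (gaussian_input P) h = log 2 (1 + P * (norm h)\<^sup>2)"
proof -
  interpret power_limited_input borel "gaussian_input P" P
    by standard (rule P, rule gaussian_input_in_input_distributions[OF P])
  have nn_integral_input: "integral\<^sup>N (gaussian_input P) f = (\<integral>\<^sup>+x. f (x, x) \<partial>cgauss P)"
    if "f \<in> borel_measurable (borel \<Otimes>\<^sub>M borel)" for f
    unfolding gaussian_input_def by (rule nn_integral_distr) (measurable, use that in simp)
  have power: "power = P"
  proof -
    have "ennreal power = (\<integral>\<^sup>+q. ennreal ((cmod (snd q))\<^sup>2) \<partial>gaussian_input P)"
      unfolding power_def by (rule nn_integral_eq_integral[symmetric, OF integrable_power]) simp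
    also have "\<dots> = ennreal P"
      by (subst nn_integral_input) (simp_all add: nn_integral_cgauss_second_moment[OF P])
    finally show ?thesis using P by (simp add: power_def)
  qed
  have out: "out n y = gauss_out P n y" for n y
  proof -
    have "ennreal (out n y) = ennreal (gauss_out P n y)"
      unfolding ennreal_out by (subst nn_integral_input) (simp_all add: nn_integral_lik_cgauss[OF P])
    then show ?thesis using gauss_out_pos[OF P, of n y] by simp
  qed
  \<comment> \<open>The message is \<open>x\<close> itself, so no averaging takes place and the
    likelihood, read as a function of \<open>u\<close>, serves as the conditional density.\<close>
  have D: "cond_density n (\<lambda>z. lik n (fst z) (snd z))" for n
    unfolding cond_density_def by (intro conjI ballI) (simp_all add: nn_integral_input)
  \<comment> \<open>The law lives on the diagonal; this is carried over to \<open>joint n\<close>,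
    where it identifies the likelihood at \<open>u\<close> with the one at \<open>x\<close>.\<close>
  have "AE q in gaussian_input P. fst q = snd q"
    unfolding gaussian_input_def by (subst AE_distr_iff) simp_all
  then have "AE q in distr (gaussian_input P \<Otimes>\<^sub>M std_cgauss) (gaussian_input P) fst. fst q = snd q"
    unfolding std_cgauss.distr_pair_fst .
  then have "AE z in gaussian_input P \<Otimes>\<^sub>M std_cgauss. fst (fst z) = snd (fst z)"
    by (subst (asm) AE_distr_iff) simp_all
  then have AE: "AE z in joint n. fst (fst z) = snd (fst z)" for n
    unfolding joint_def by (subst AE_density) auto
  have "scalar_MI n (\<lambda>z. lik n (fst z) (snd z)) = ln (1 + P * n\<^sup>2)" for n
  proof -
    have "scalar_MI n (\<lambda>z. lik n (fst z) (snd z)) =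
        (\<integral>z. ln (lik n (snd (fst z)) (snd z)) - ln (gauss_out P n (snd z)) \<partial>joint n)"
      unfolding scalar_MI_def
    proof (rule integral_cong_AE)
      show "AE z in joint n. ln (lik n (fst (fst (fst z), snd z)) (snd (fst (fst z), snd z)) / out n (snd z)) =
          ln (lik n (snd (fst z)) (snd z)) - ln (gauss_out P n (snd z))"
        using AE
      proof eventually_elim
        case (elim z)
        show ?case
          using gauss_out_pos[OF P, of n "snd z"] by (simp add: elim out ln_div)
      qed
    qed measurable
    \<comment> \<open>The full power is spent, so the term with \<open>power - P\<close>
      vanishes.\<close>
    also have "\<dots> = ln (1 + P * n\<^sup>2)"
      using has_bochner_integral_joint_log_ratio[of n] by (simp add: has_bochner_integral_iff power)
    finally show ?thesis .
  qed
  then show ?thesis by (simp add: instantaneous_MI_eq[OF D] log_def)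
qed

theorem theorem3:
  fixes M :: "'w measure"
    and h :: "'w \<Rightarrow> complex ^ 'b::finite"
    and g :: "'w \<Rightarrow> complex ^ 'e::finite"
    and r P :: real
  assumes "prob_space M"
    and "h \<in> borel_measurable M" and "g \<in> borel_measurable M"
    and "r \<ge> 0" and "P > 0"
  shows "gaussian_input P \<in> input_distributions borel P \<and>
    SOP M h g borel (gaussian_input P) r =
      measure M {\<omega> \<in> space M. log 2 ((1 + P * (norm (h \<omega>))\<^sup>2) / (1 + P * (norm (g \<omega>))\<^sup>2)) < r} \<and>
    (r > 0 \<longrightarrow>
      (\<forall>(U :: 'u measure) p. p \<in> input_distributions U P \<longrightarrow>
        SOP M h g borel (gaussian_input P) r \<le> SOP M h g U p r))"
proof (intro conjI impI allI)
  show "gaussian_input P \<in> input_distributions borel P"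
    by (rule gaussian_input_in_input_distributions) fact
  interpret prob_space M by fact
  note [measurable] = assms(2,3)
  let ?ratio = "\<lambda>\<omega>. (1 + P * (norm (h \<omega>))\<^sup>2) / (1 + P * (norm (g \<omega>))\<^sup>2)"
  have "0 < 1 + P * t\<^sup>2" for t using assms(5) by (intro add_pos_nonneg) auto
  then have log_ratio: "log 2 (?ratio \<omega>) = log 2 (1 + P * (norm (h \<omega>))\<^sup>2) - log 2 (1 + P * (norm (g \<omega>))\<^sup>2)" for \<omega>
    by (simp add: log_divide_pos)
  then show eq: "SOP M h g borel (gaussian_input P) r = measure M {\<omega> \<in> space M. log 2 (?ratio \<omega>) < r}"
    by (simp add: SOP_def instantaneous_MI_gaussian_input[OF assms(5)])
  fix U :: "'u measure" and p assume "r > 0" and "p \<in> input_distributions U P"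
  interpret input: power_limited_input U p P by standard fact+
  show "SOP M h g borel (gaussian_input P) r \<le> SOP M h g U p r"
    unfolding eq unfolding SOP_def
  proof (rule finite_measure_mono)
    show "{\<omega> \<in> space M. instantaneous_MI U p (h \<omega>) - instantaneous_MI U p (g \<omega>) < r} \<in> sets M"
      by measurable
    \<comment> \<open>The inclusion holds for every channel state separately, so dependence between
      \<open>h\<close> and \<open>g\<close> is immaterial.\<close>
    show "{\<omega> \<in> space M. log 2 (?ratio \<omega>) < r} \<subseteq>
        {\<omega> \<in> space M. instantaneous_MI U p (h \<omega>) - instantaneous_MI U p (g \<omega>) < r}"
    proof safe
      fix \<omega> assume less: "log 2 (?ratio \<omega>) < r"
      show "instantaneous_MI U p (h \<omega>) - instantaneous_MI U p (g \<omega>) < r"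
      proof (cases "norm (g \<omega>) \<le> norm (h \<omega>)")
        case True
        then show ?thesis using input.instantaneous_MI_mono(2)[OF True] less by linarith
      next
        case False
        then have "instantaneous_MI U p (h \<omega>) \<le> instantaneous_MI U p (g \<omega>)"
          by (intro input.instantaneous_MI_mono(1)) simp
        \<comment> \<open>When the eavesdropper has the stronger channel the difference is at most
          0, and the strict positivity of \<open>r\<close> makes this an outage. At
          \<open>r = 0\<close> a difference equal to 0 would not count as one.\<close>
        then show ?thesis using \<open>r > 0\<close> by linarith
      qed
    qed
  qed
qed

end
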